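(* Fix $k\in\{1,2,\dots\}\cup\{\infty\}$. For $a>0$ let $\mathcal{S}_a$ be the $C^k$-structure on $\mathbb{L}$ given by the special minimal atlas of $w_a$. Then: (1) If $a=1$ (so $w_1=\mathrm{id}_{\mathbb{R}}$), there is a group isomorphism $\eta\colon \mathrm{Diff}(\mathcal{S}_1)\to D^k(\mathbb{R},0)\times\mathbb{Z}_2$ (with $\mathbb{Z}_2=\{\pm1\}$) such that for $*\in\{+,-\}$: $\eta(\mathrm{Diff}^{*,\mathrm{fix}}(\mathcal{S}_1))=D^{k,*}(\mathbb{R},0)\times\{1\}$ and $\eta(\mathrm{Diff}^{*,\mathrm{ex}}(\mathcal{S}_1))=D^{k,*}(\mathbb{R},0)\times\{-1\}$. (2) If $a\neq1$, then $\mathrm{Diff}^{+,\mathrm{ex}}(\mathcal{S}_a)=\mathrm{Diff}^{-,\mathrm{fix}}(\mathcal{S}_a)=\varnothing$ and $\mathrm{Diff}(\mathcal{S}_a)=\mathrm{Diff}^{+,\mathrm{fix}}(\mathcal{S}_a)\sqcup\mathrm{Diff}^{-,\mathrm{ex}}(\mathcal{S}_a)$. Moreover there is a group isomorphism $\mathrm{Diff}^{+,\mathrm{fix}}(\mathcal{S}_a)\cong E^{k,+}(\mathbb{R},0)$, and there exists an element $p\in\mathrm{Diff}^{-,\mathrm{ex}}(\mathcal{S}_a)$ of order $2$; hence $\mathrm{Diff}(\mathcal{S}_a)$ splits as a semidirect product $\mathrm{Diff}^{+,\mathrm{fix}}(\mathcal{S}_a)\rtimes\langle p\rangle$, and so is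 isomorphic to some semidirect product $E^{k,+}(\mathbb{R},0)\rtimes\mathbb{Z}_2$. (3) If $a\neq 1$, then $\mathcal{S}_a$ and $\mathcal{S}_{1/a}$ are $C^k$-diffeomorphic; more precisely $\mathrm{Diff}^{+,\mathrm{fix}}(\mathcal{S}_a,\mathcal{S}_{1/a})=\mathrm{Diff}^{-,\mathrm{ex}}(\mathcal{S}_a,\mathcal{S}_{1/a})=\varnothing$, $\mathrm{Diff}(\mathcal{S}_a,\mathcal{S}_{1/a})=\mathrm{Diff}^{+,\mathrm{ex}}(\mathcal{S}_a,\mathcal{S}_{1/a})\sqcup\mathrm{Diff}^{-,\mathrm{fix}}(\mathcal{S}_a,\mathcal{S}_{1/a})$, and for every $h\in\mathrm{Diff}^{-,\mathrm{fix}}(\mathcal{S}_a,\mathcal{S}_{1/a})$ and $g\in\mathrm{Diff}^{+,\mathrm{ex}}(\mathcal{S}_a,\mathcal{S}_{1/a})$ the maps $\kappa\mapsto g^{-1}\circ\kappa$ and $\kappa\mapsto h\circ\kappa$ are bijections $\mathrm{Diff}^{+,\mathrm{ex}}(\mathcal{S}_a,\mathcal{S}_{1/a})\to\mathrm{Diff}^{+,\mathrm{fix}}(\mathcal{S}_a)$ and $\mathrm{Diff}^{+,\mathrm{fix}}(\mathcal{S}_a)\to\mathrm{Diff}^{-,\mathrm{fix}}(\mathcal{S}_a,\mathcal{S}_{1/a})$ respectively. (4) If $a,b>0$ with $a\neq b$ and $a\neq 1/b$, then $\mathrm{Diff}(\mathcal{S}_a,\mathcal{S}_b)=\varnothing$.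 In particular, $\mathbb{L}$ has uncountably many pairwise non-diffeomorphic $C^k$-structures.
   Context: $\mathbb{L}=\mathbb{R}\sqcup\{0'\}$ is the line with two origins: its open sets are the open subsets of $\mathbb{R}$ and the sets $(W\setminus\{0\})\cup\{0'\}$ with $W\subset\mathbb{R}$ open, $0\in W$. Put $U=\mathbb{L}\setminus\{0'\}=\mathbb{R}$, $V=\mathbb{L}\setminus\{0\}$. $C^k$-atlases, $C^k$-structures (equivalence classes of atlases whose union is again a $C^k$-atlas) and $C^k$-diffeomorphisms between structures on $\mathbb{L}$ are defined via charts (homeomorphisms of open subsets of $\mathbb{L}$ onto open subsets of $\mathbb{R}$) as for manifolds. Every homeomorphism of $\mathbb{L}$ either fixes both $0,0'$ or exchanges them, and maps $\mathbb{R}\setminus\{0\}$ onto itself; it preserves (reverses) orientation if its restriction to $\mathbb{R}\setminus\{0\}$ is increasing (decreasing). For structures $\mathcal{S},\mathcal{T}$: $\mathrm{Diff}(\mathcal{S},\mathcal{T})$ is the set of $C^k$-diffeomorphisms $(\mathbb{L},\mathcal{S})\to(\mathbb{L},\mathcal{T})$; $\mathrm{Diff}^{*,\bullet}(\mathcal{S},\mathcal{T})$, $*\in\{+,-\}$, $\bullet\in\{\mathrm{fix},\mathrm{ex}\}$, the subset of those preserving ($+$) / reversing ($-$) orientation and fixing ($\mathrm{fix}$) / exchanging ($\mathrm{ex}$) $0$ and $0'$; $\mathrm{Diff}(\mathcal{S})=\mathrm{Diff}(\mathcal{S},\mathcal{S})$ etc. $H^k(\mathbb{R},0)$: homeomorphisms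 $h$ of $\mathbb{R}$ with $h(0)=0$ restricting to a $C^k$-diffeomorphism of $\mathbb{R}\setminus\{0\}$. $D^k(\mathbb{R},0)$: $C^k$-diffeomorphisms of $\mathbb{R}$ fixing $0$; $D^{k,+}$, $D^{k,-}$ its orientation preserving / reversing elements. $E^{k,+}(\mathbb{R},0)$: orientation preserving $h\in D^k(\mathbb{R},0)$ with $h^{(i)}(0)=0$ for all integers $2\le i\le k$ (all $i\ge2$ if $k=\infty$). Let $\mathrm{id}_U\colon U\to\mathbb{R}$ be the identity and $\mathrm{id}_V\colon V\to\mathbb{R}$ be $\mathrm{id}_V(0')=0$, $\mathrm{id}_V(x)=x$ for $x\ne0'$. For $h\in H^k(\mathbb{R},0)$ the special minimal atlas of $h$ is the $C^k$-atlas $\{(U,\mathrm{id}_U),(V,h\circ\mathrm{id}_V)\}$. For $a>0$, $w_a\in H^k(\mathbb{R},0)$ is $w_a(x)=x$ for $x\le0$ and $w_a(x)=ax$ for $x>0$. *)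

theory Defs
  imports "HOL-Analysis.Analysis" "HOL-Library.Extended_Nat"
begin

section \<open>The line with two origins\<close>

text \<open>Points of L: Pt x for x real (so Pt 0 is the origin 0), and Org2 (the second origin 0').\<close>
datatype L = Pt real | Org2

definition Lopen :: "L set \<Rightarrow> bool" where
  "Lopen S \<longleftrightarrow> open (Pt -` S) \<and> (Org2 \<in> S \<longrightarrow> open (insert 0 (Pt -` S)))"

lemma istopology_Lopen: "istopology Lopen"
  unfolding istopology_def
proof (intro conjI allI impI ballI)
  fix S T assume S: "Lopen S" and T: "Lopen T"
  show "Lopen (S \<inter> T)"
  proof -
    have "Pt -` (S \<inter> T) = Pt -` S \<inter> Pt -` T" by auto
    moreover have "insert 0 (Pt -` (S \<inter> T)) = insert 0 (Pt -` S) \<inter> insert 0 (Pt -` T)" by auto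
    ultimately show ?thesis using S T unfolding Lopen_def by (metis IntE open_Int)
  qed
next
  fix K assume K: "\<forall>S\<in>K. Lopen S"
  show "Lopen (\<Union>K)"
    unfolding Lopen_def
  proof (intro conjI impI)
    have "Pt -` (\<Union>K) = (\<Union>S\<in>K. Pt -` S)" by auto
    then show "open (Pt -` \<Union>K)" using K unfolding Lopen_def by auto
  next
    assume "Org2 \<in> \<Union>K"
    then obtain S0 where S0: "S0 \<in> K" "Org2 \<in> S0" by auto
    have "insert 0 (Pt -` \<Union>K) = insert 0 (Pt -` S0) \<union> (\<Union>S\<in>K. Pt -` S)" using S0 by auto
    moreover have "open (\<Union>S\<in>K. Pt -` S)" using K unfolding Lopen_def by auto
    moreover have "open (insert 0 (Pt -` S0))" using K S0 unfolding Lopen_def by auto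
    ultimately show "open (insert 0 (Pt -` \<Union>K))" by (metis open_Un)
  qed
qed

definition Ltop :: "L topology" where "Ltop = topology Lopen"

text \<open>The maps id_U and id_V (both are this map restricted to U resp. V).\<close>
fun real_of_L :: "L \<Rightarrow> real" where
  "real_of_L (Pt x) = x" | "real_of_L Org2 = 0"

definition LU :: "L set" where "LU = range Pt"
definition LV :: "L set" where "LV = - {Pt 0}"

section \<open>C^k functions of one real variable (k a positive natural number or infinity)\<close>

definition Cn_on :: "nat \<Rightarrow> real set \<Rightarrow> (real \<Rightarrow> real) \<Rightarrow> bool" where
  "Cn_on n S f \<longleftrightarrow> (\<exists>D :: nat \<Rightarrow> real \<Rightarrow> real.
      (\<forall>x\<in>S. D 0 x = f x) \<and>
      (\<forall>i<n. \<forall>x\<in>S. (D i has_real_derivative D (Suc i) x) (at x within S)) \<and>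
      continuous_on S (D n))"

definition Ck_on :: "enat \<Rightarrow> real set \<Rightarrow> (real \<Rightarrow> real) \<Rightarrow> bool" where
  "Ck_on k S f \<longleftrightarrow> (\<forall>n::nat. enat n \<le> k \<longrightarrow> Cn_on n S f)"

section \<open>Charts, atlases, structures on L\<close>

type_synonym chart = "L set \<times> (L \<Rightarrow> real)"

definition is_chart :: "chart \<Rightarrow> bool" where
  "is_chart c \<longleftrightarrow> (case c of (U, \<phi>) \<Rightarrow>
     Lopen U \<and> open (\<phi> ` U) \<and>
     homeomorphic_map (subtopology Ltop U) (subtopology euclideanreal (\<phi> ` U)) \<phi>)"

text \<open>Transition map psi o phi^-1 : phi(U \<inter> V) \<rightarrow> psi(U \<inter> V) is C^k.\<close>
definition Ck_compatible :: "enat \<Rightarrow> chart \<Rightarrow> chart \<Rightarrow> bool" where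
  "Ck_compatible k c d \<longleftrightarrow> (case c of (U, \<phi>) \<Rightarrow> case d of (V, \<psi>) \<Rightarrow>
     Ck_on k (\<phi> ` (U \<inter> V)) (\<psi> \<circ> inv_into U \<phi>))"

definition Ck_atlas :: "enat \<Rightarrow> chart set \<Rightarrow> bool" where
  "Ck_atlas k A \<longleftrightarrow> (\<forall>c\<in>A. is_chart c) \<and> \<Union> (fst ` A) = UNIV \<and>
     (\<forall>c\<in>A. \<forall>d\<in>A. Ck_compatible k c d)"

text \<open>The C^k-structure determined by an atlas A: its equivalence class of atlases.\<close>
definition Ck_struct_of :: "enat \<Rightarrow> chart set \<Rightarrow> chart set set" where
  "Ck_struct_of k A = {B. Ck_atlas k B \<and> Ck_atlas k (A \<union> B)}"

definition is_Ck_structure :: "enat \<Rightarrow> chart set set \<Rightarrow> bool" where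
  "is_Ck_structure k S \<longleftrightarrow> (\<exists>A. Ck_atlas k A \<and> S = Ck_struct_of k A)"

section \<open>Diffeomorphisms\<close>

text \<open>f is C^k from S to T: in all charts of the (maximal atlases of the) structures.\<close>
definition Ck_map :: "enat \<Rightarrow> chart set set \<Rightarrow> chart set set \<Rightarrow> (L \<Rightarrow> L) \<Rightarrow> bool" where
  "Ck_map k S T f \<longleftrightarrow> (\<forall>(U, \<phi>)\<in>\<Union>S. \<forall>(V, \<psi>)\<in>\<Union>T.
     Ck_on k (\<phi> ` (U \<inter> f -` V)) (\<psi> \<circ> f \<circ> inv_into U \<phi>))"

definition Diff :: "enat \<Rightarrow> chart set set \<Rightarrow> chart set set \<Rightarrow> (L \<Rightarrow> L) set" where
  "Diff k S T = {f. homeomorphic_map Ltop Ltop f \<and> Ck_map k S T f \<and> Ck_map k T S (inv f)}"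

definition orient_pres :: "(L \<Rightarrow> L) \<Rightarrow> bool" where
  "orient_pres f \<longleftrightarrow> strict_mono_on (- {0}) (\<lambda>x. real_of_L (f (Pt x)))"

definition orient_rev :: "(L \<Rightarrow> L) \<Rightarrow> bool" where
  "orient_rev f \<longleftrightarrow> strict_antimono_on (- {0}) (\<lambda>x. real_of_L (f (Pt x)))"

definition fixes_origins :: "(L \<Rightarrow> L) \<Rightarrow> bool" where
  "fixes_origins f \<longleftrightarrow> f (Pt 0) = Pt 0 \<and> f Org2 = Org2"

definition exchanges_origins :: "(L \<Rightarrow> L) \<Rightarrow> bool" where
  "exchanges_origins f \<longleftrightarrow> f (Pt 0) = Org2 \<and> f Org2 = Pt 0"

text \<open>Diff^{*,bullet}(S,T): pos = True means +, fx = True means fix.\<close>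
definition Diff_sub :: "enat \<Rightarrow> bool \<Rightarrow> bool \<Rightarrow> chart set set \<Rightarrow> chart set set \<Rightarrow> (L \<Rightarrow> L) set" where
  "Diff_sub k pos fx S T = {f \<in> Diff k S T.
     (if pos then orient_pres f else orient_rev f) \<and>
     (if fx then fixes_origins f else exchanges_origins f)}"

section \<open>Groups of germs at 0 on the real line\<close>

definition Dk :: "enat \<Rightarrow> (real \<Rightarrow> real) set" where
  "Dk k = {h. bij h \<and> h 0 = 0 \<and> Ck_on k UNIV h \<and> Ck_on k UNIV (inv h)}"

definition Dk_plus :: "enat \<Rightarrow> (real \<Rightarrow> real) set" where
  "Dk_plus k = {h \<in> Dk k. strict_mono h}"

definition Dk_minus :: "enat \<Rightarrow> (real \<Rightarrow> real) set" where
  "Dk_minus k = {h \<in> Dk k. strict_antimono_on UNIV h}"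

definition Ek_plus :: "enat \<Rightarrow> (real \<Rightarrow> real) set" where
  "Ek_plus k = {h \<in> Dk_plus k. \<forall>i::nat. 2 \<le> i \<and> enat i \<le> k \<longrightarrow> (deriv ^^ i) h 0 = 0}"

definition Z2 :: "int set" where "Z2 = {1, -1}"

section \<open>Special minimal atlases and the structures S_a\<close>

definition special_atlas :: "(real \<Rightarrow> real) \<Rightarrow> chart set" where
  "special_atlas h = {(LU, real_of_L), (LV, h \<circ> real_of_L)}"

definition w :: "real \<Rightarrow> real \<Rightarrow> real" where
  "w a x = (if x \<le> 0 then x else a * x)"

definition S_a :: "enat \<Rightarrow> real \<Rightarrow> chart set set" where
  "S_a k a = Ck_struct_of k (special_atlas (w a))"

end

theory Submission
  imports Defs
begin

text \<open>A homeomorphism \<open>f\<close> of the line with two origins is determined by the homeomorphism \<open>u\<close> of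
  \<open>\<real>\<close> it induces, which fixes \<open>0\<close>, and by whether it fixes or exchanges the origins. In the charts
  around the origins, \<open>f\<close> is a diffeomorphism between the special structures of \<open>g\<close> and \<open>h\<close> iff \<open>u\<close>
  and \<open>h \<circ> u \<circ> inv g\<close> are diffeomorphisms of \<open>\<real>\<close> (origins fixed), respectively \<open>h \<circ> u\<close> and
  \<open>u \<circ> inv g\<close> are (origins exchanged). For \<open>g = w a\<close>, \<open>h = w b\<close> and increasing \<open>u\<close> with \<open>i\<close>-th
  derivative \<open>d\<close> at \<open>0\<close>, the map \<open>w b \<circ> u \<circ> w (1 / a)\<close> has \<open>i\<close>-th derivatives \<open>d\<close> from the left
  and \<open>b d / a ^ i\<close> from the right; the first order forces \<open>a = b\<close>, and for \<open>a \<noteq> 1\<close> the higher orders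
  force \<open>d = 0\<close>, which conversely suffices to glue. For decreasing \<open>u\<close> the slopes force \<open>a = 1 / b\<close>.
  Since \<open>w b\<close> itself induces a diffeomorphism from \<open>S_b\<close> to \<open>S_{1/b}\<close> exchanging the origins,
  exchanging the origins replaces \<open>b\<close> by \<open>1 / b\<close>.\<close>

section \<open>Functions of class \<open>C\<^sup>k\<close>\<close>

lemma Cn_on_cong:
  assumes "\<And>x. x \<in> S \<Longrightarrow> f x = g x"
  shows "Cn_on n S f \<longleftrightarrow> Cn_on n S g"
  using assms unfolding Cn_on_def by simp

lemma Cn_on_subset:
  assumes "Cn_on n S f" "T \<subseteq> S"
  shows "Cn_on n T f"
proof -
  obtain D where "\<forall>x\<in>S. D 0 x = f x"
    "\<forall>i<n. \<forall>x\<in>S. (D i has_real_derivative D (Suc i) x) (at x within S)" "continuous_on S (D n)"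
    using assms(1) unfolding Cn_on_def by blast
  with assms(2) show ?thesis
    unfolding Cn_on_def
    by (intro exI[of _ D]) (blast intro: DERIV_subset continuous_on_subset)
qed

lemma Cn_on_0: "Cn_on 0 S f \<longleftrightarrow> continuous_on S f"
proof
  assume "Cn_on 0 S f"
  then obtain D :: "nat \<Rightarrow> real \<Rightarrow> real" where "\<forall>x\<in>S. D 0 x = f x" "continuous_on S (D 0)"
    unfolding Cn_on_def by blast
  then show "continuous_on S f" by (simp cong: continuous_on_cong)
qed (auto simp: Cn_on_def)

lemma Cn_on_SucI:
  assumes f': "\<And>x. x \<in> S \<Longrightarrow> (f has_real_derivative f' x) (at x within S)" and "Cn_on n S f'"
  shows "Cn_on (Suc n) S f"
proof -
  obtain D where D: "\<forall>x\<in>S. D 0 x = f' x"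
    "\<forall>i<n. \<forall>x\<in>S. (D i has_real_derivative D (Suc i) x) (at x within S)" "continuous_on S (D n)"
    using assms(2) unfolding Cn_on_def by blast
  show ?thesis
    unfolding Cn_on_def
  proof (intro exI[of _ "case_nat f D"] conjI ballI allI impI)
    fix i x assume "i < Suc n" "x \<in> S"
    then show "(case_nat f D i has_real_derivative case_nat f D (Suc i) x) (at x within S)"
      using f' D by (cases i) auto
  qed (use D in auto)
qed

lemma Cn_on_SucE:
  assumes "Cn_on (Suc n) S f"
  obtains f' where "\<forall>x\<in>S. (f has_real_derivative f' x) (at x within S)" "Cn_on n S f'"
proof -
  obtain D where D: "\<forall>x\<in>S. D 0 x = f x"
    "\<forall>i<Suc n. \<forall>x\<in>S. (D i has_real_derivative D (Suc i) x) (at x within S)"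
    "continuous_on S (D (Suc n))"
    using assms unfolding Cn_on_def by blast
  show ?thesis
  proof (rule that[of "D 1"])
    show "\<forall>x\<in>S. (f has_real_derivative D 1 x) (at x within S)"
      using has_field_derivative_transform_within[of "D 0" _ _ S 1 f] D by auto
    show "Cn_on n S (D 1)"
      unfolding Cn_on_def using D by (intro exI[of _ "\<lambda>i. D (Suc i)"]) auto
  qed
qed

lemma Cn_on_mono:
  assumes "Cn_on n S f" "m \<le> n"
  shows "Cn_on m S f"
proof -
  obtain D where D: "\<forall>x\<in>S. D 0 x = f x"
    "\<forall>i<n. \<forall>x\<in>S. (D i has_real_derivative D (Suc i) x) (at x within S)" "continuous_on S (D n)"
    using assms(1) unfolding Cn_on_def by blast
  have "continuous_on S (D m)"
    using D assms(2) DERIV_continuous_on[of S "D m" "D (Suc m)"] by (cases "m = n") auto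
  with D assms(2) show ?thesis unfolding Cn_on_def by (intro exI[of _ D]) auto
qed

lemma Cn_on_const: "Cn_on n S (\<lambda>x. c)"
  unfolding Cn_on_def by (intro exI[of _ "\<lambda>i x. if i = 0 then c else 0"]) auto

lemma Cn_on_id: "Cn_on n S (\<lambda>x. x)"
proof (cases n)
  case (Suc m)
  then show ?thesis
    using Cn_on_SucI[of S "\<lambda>x. x" "\<lambda>_. 1" m] by (simp add: Cn_on_const)
qed (simp add: Cn_on_0)

lemma Cn_on_add:
  assumes "Cn_on n S f" "Cn_on n S g"
  shows "Cn_on n S (\<lambda>x. f x + g x)"
  using assms
proof (induction n arbitrary: f g)
  case 0
  then show ?case by (simp add: Cn_on_0 continuous_on_add)
next
  case (Suc n)
  obtain f' where f': "\<forall>x\<in>S. (f has_real_derivative f' x) (at x within S)" "Cn_on n S f'"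
    using Suc.prems(1) by (rule Cn_on_SucE)
  obtain g' where g': "\<forall>x\<in>S. (g has_real_derivative g' x) (at x within S)" "Cn_on n S g'"
    using Suc.prems(2) by (rule Cn_on_SucE)
  show ?case
    by (rule Cn_on_SucI[OF DERIV_add[OF bspec[OF f'(1)] bspec[OF g'(1)]] Suc.IH[OF f'(2) g'(2)]])
qed

lemma Cn_on_mult:
  assumes "Cn_on n S f" "Cn_on n S g"
  shows "Cn_on n S (\<lambda>x. f x * g x)"
  using assms
proof (induction n arbitrary: f g)
  case 0
  then show ?case by (simp add: Cn_on_0 continuous_on_mult)
next
  case (Suc n)
  obtain f' where f': "\<forall>x\<in>S. (f has_real_derivative f' x) (at x within S)" "Cn_on n S f'"
    using Suc.prems(1) by (rule Cn_on_SucE)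
  obtain g' where g': "\<forall>x\<in>S. (g has_real_derivative g' x) (at x within S)" "Cn_on n S g'"
    using Suc.prems(2) by (rule Cn_on_SucE)
  have "Cn_on n S f" "Cn_on n S g" using Suc.prems Cn_on_mono[of "Suc n"] by auto
  with f'(2) g'(2) have "Cn_on n S (\<lambda>x. f' x * g x + g' x * f x)"
    by (intro Cn_on_add Suc.IH)
  from Cn_on_SucI[OF DERIV_mult[OF bspec[OF f'(1)] bspec[OF g'(1)]] this] show ?case .
qed

lemma Cn_on_compose:
  assumes "f ` S \<subseteq> T" "Cn_on n S f" "Cn_on n T g"
  shows "Cn_on n S (\<lambda>x. g (f x))"
  using assms(2,3)
proof (induction n arbitrary: g)
  case 0
  then show ?case using assms(1) by (auto simp: Cn_on_0 intro: continuous_on_compose2)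
next
  case (Suc n)
  obtain f' where f': "\<forall>x\<in>S. (f has_real_derivative f' x) (at x within S)" "Cn_on n S f'"
    using Suc.prems(1) by (rule Cn_on_SucE)
  obtain g' where g': "\<forall>x\<in>T. (g has_real_derivative g' x) (at x within T)" "Cn_on n T g'"
    using Suc.prems(2) by (rule Cn_on_SucE)
  have "((\<lambda>x. g (f x)) has_real_derivative g' (f x) * f' x) (at x within S)" if "x \<in> S" for x
    using DERIV_image_chain[OF DERIV_subset[OF bspec[OF g'(1)] assms(1)] bspec[OF f'(1) that]]
      assms(1) that
    by (auto simp: comp_def)
  moreover have "Cn_on n S (\<lambda>x. g' (f x) * f' x)"
    using Suc Cn_on_mono[of "Suc n"] f'(2) g'(2) by (auto intro!: Cn_on_mult)
  ultimately show ?case by (rule Cn_on_SucI)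
qed

lemma Cn_on_inverse:
  assumes "\<And>x. x \<in> S \<Longrightarrow> f x \<noteq> 0" "Cn_on n S f"
  shows "Cn_on n S (\<lambda>x. inverse (f x))"
  using assms(2)
proof (induction n)
  case 0
  then show ?case using assms(1) by (auto simp: Cn_on_0 intro: continuous_on_inverse)
next
  case (Suc n)
  obtain f' where f': "\<forall>x\<in>S. (f has_real_derivative f' x) (at x within S)" "Cn_on n S f'"
    using Suc.prems by (rule Cn_on_SucE)
  have "((\<lambda>x. inverse (f x)) has_real_derivative (-1) * (inverse (f x) * f' x * inverse (f x)))
      (at x within S)" if "x \<in> S" for x
    using DERIV_inverse'[OF bspec[OF f'(1)]] assms(1) that by simp
  moreover have "Cn_on n S (\<lambda>x. (-1) * (inverse (f x) * f' x * inverse (f x)))"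
    using Suc f'(2) Cn_on_mono[of "Suc n"] by (intro Cn_on_mult Cn_on_const) auto
  ultimately show ?case by (rule Cn_on_SucI)
qed

lemma Cn_on_scale: "Cn_on n UNIV f \<Longrightarrow> Cn_on n UNIV (\<lambda>x. b * f (c * x))"
  by (intro Cn_on_mult Cn_on_const Cn_on_id Cn_on_compose[where T = UNIV and f = "(*) c" and g = f])
    auto

lemma Cn_on_Suc_imp_deriv:
  assumes "open S" "Cn_on (Suc n) S f"
  shows "x \<in> S \<Longrightarrow> (f has_real_derivative deriv f x) (at x)" "Cn_on n S (deriv f)"
proof -
  obtain f' where f': "\<forall>x\<in>S. (f has_real_derivative f' x) (at x within S)" "Cn_on n S f'"
    using assms(2) by (rule Cn_on_SucE)
  have der: "(f has_real_derivative f' x) (at x)" if "x \<in> S" for x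
    using bspec[OF f'(1) that] at_within_open[OF that assms(1)] by simp
  then have deriv: "deriv f x = f' x" if "x \<in> S" for x using DERIV_imp_deriv that by blast
  show "(f has_real_derivative deriv f x) (at x)" if "x \<in> S"
    using der[OF that] deriv[OF that] by simp
  show "Cn_on n S (deriv f)" using Cn_on_cong[THEN iffD2, OF deriv f'(2)] .
qed

lemma Cn_on_local:
  assumes "\<And>x. x \<in> S \<Longrightarrow> \<exists>T. open T \<and> x \<in> T \<and> T \<subseteq> S \<and> Cn_on n T f"
  shows "Cn_on n S f"
  using assms
proof (induction n arbitrary: f)
  case 0
  then show ?case
    by (metis Cn_on_0 continuous_at_imp_continuous_on continuous_on_eq_continuous_at)
next
  case (Suc n)
  show ?case
  proof (rule Cn_on_SucI)
    show "(f has_real_derivative deriv f x) (at x within S)" if "x \<in> S" for x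
      using Suc.prems[OF that] Cn_on_Suc_imp_deriv(1) has_field_derivative_at_within by blast
    show "Cn_on n S (deriv f)"
    proof (rule Suc.IH)
      show "\<exists>T. open T \<and> x \<in> T \<and> T \<subseteq> S \<and> Cn_on n T (deriv f)" if "x \<in> S" for x
        using Suc.prems[OF that] Cn_on_Suc_imp_deriv(2) by blast
    qed
  qed
qed

lemma Cn_on_inv:
  assumes "bij h" "continuous_on UNIV (inv h)" "\<And>x. deriv h x \<noteq> 0" "Cn_on n UNIV h"
  shows "Cn_on n UNIV (inv h)"
  using assms(4)
proof (induction n)
  case 0
  then show ?case using assms(2) by (simp add: Cn_on_0)
next
  case (Suc n)
  note h' = Cn_on_Suc_imp_deriv[OF open_UNIV Suc.prems]
  have "(inv h has_real_derivative inverse (deriv h (inv h x))) (at x)" for x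
    by (rule has_field_derivative_inverse_basic[OF h'(1) _ _ open_UNIV])
       (use assms in \<open>auto simp: continuous_on_eq_continuous_at bij_is_surj surj_f_inv_f\<close>)
  moreover have "Cn_on n UNIV (\<lambda>x. inverse (deriv h (inv h x)))"
    using assms(3) h'(2) Suc Cn_on_mono[of "Suc n"]
    by (intro Cn_on_inverse Cn_on_compose[where T = UNIV and f = "inv h" and g = "deriv h"]) auto
  ultimately show ?case by (intro Cn_on_SucI) auto
qed

lemma Cn_on_glue:
  assumes "Cn_on n UNIV u" "Cn_on n UNIV v" "\<And>i. i \<le> n \<Longrightarrow> (deriv ^^ i) u c = (deriv ^^ i) v c"
  shows "Cn_on n UNIV (\<lambda>x. if x \<le> c then u x else v x)"
  using assms
proof (induction n arbitrary: u v)
  case 0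
  then have "continuous_on ({..c} \<union> {c..}) (\<lambda>x. if x \<le> c then u x else v x)"
    by (intro continuous_on_If) (auto simp: Cn_on_0 intro: continuous_on_subset)
  moreover have "{..c} \<union> {c..} = UNIV" by auto
  ultimately show ?case by (simp add: Cn_on_0)
next
  case (Suc n)
  note u' = Cn_on_Suc_imp_deriv[OF open_UNIV Suc.prems(1)]
    and v' = Cn_on_Suc_imp_deriv[OF open_UNIV Suc.prems(2)]
  have at_c: "u c = v c" "deriv u c = deriv v c" using Suc.prems(3)[of 0] Suc.prems(3)[of 1] by auto
  show ?case
  proof (rule Cn_on_SucI)
    fix x
    have "x = c" if "x \<in> closure {..c}" "x \<in> closure {c<..}" using that by simp
    then have "((\<lambda>x. if x \<in> {..c} then u x else v x) has_vector_derivative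
        (if x \<in> {..c} then deriv u x else deriv v x)) (at x within UNIV)"
      using at_c u'(1) v'(1)
      by (intro has_vector_derivative_If_within_closures[of _ _ "{c<..}"])
        (auto simp flip: has_real_derivative_iff_has_vector_derivative
          intro: has_field_derivative_at_within)
    then show "((\<lambda>x. if x \<le> c then u x else v x) has_real_derivative
        (if x \<le> c then deriv u x else deriv v x)) (at x within UNIV)"
      by (simp add: has_real_derivative_iff_has_vector_derivative)
    show "Cn_on n UNIV (\<lambda>x. if x \<le> c then deriv u x else deriv v x)"
    proof (rule Suc.IH[OF u'(2) v'(2)])
      show "(deriv ^^ i) (deriv u) c = (deriv ^^ i) (deriv v) c" if "i \<le> n" for i
        using Suc.prems(3)[of "Suc i"] that by (simp add: funpow_swap1)
    qed
  qed
qed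

lemma continuous_on_higher_deriv:
  assumes "open S" "Cn_on n S f"
  shows "continuous_on S ((deriv ^^ n) f)"
  using assms(2)
proof (induction n arbitrary: f)
  case (Suc n)
  from Suc.IH[OF Cn_on_Suc_imp_deriv(2)[OF assms(1) Suc.prems]] show ?case
    by (simp add: funpow_swap1)
qed (simp add: Cn_on_0)

lemma higher_deriv_eq_on_closure:
  assumes "Cn_on n UNIV f" "Cn_on n UNIV g" "open S" "\<And>x. x \<in> S \<Longrightarrow> f x = g x" "x \<in> closure S"
  shows "(deriv ^^ n) f x = (deriv ^^ n) g x"
proof (rule forall_in_closure_of_eq[where f = "(deriv ^^ n) f" and g = "(deriv ^^ n) g"])
  show "x \<in> euclidean closure_of S" using assms(5) by simp
  show "continuous_map euclidean euclideanreal ((deriv ^^ n) f)"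
    "continuous_map euclidean euclideanreal ((deriv ^^ n) g)"
    using continuous_on_higher_deriv[OF open_UNIV] assms(1,2) by simp_all
  show "(deriv ^^ n) f y = (deriv ^^ n) g y" if "y \<in> S" for y
    using that assms(3,4) by (intro higher_deriv_cong_ev) (auto simp: eventually_nhds)
qed simp

lemma higher_deriv_scale:
  assumes "Cn_on n UNIV f"
  shows "(deriv ^^ n) (\<lambda>x. b * f (c * x)) x = b * c ^ n * (deriv ^^ n) f (c * x)"
  using assms
proof (induction n arbitrary: b f)
  case (Suc n)
  note f' = Cn_on_Suc_imp_deriv[OF open_UNIV Suc.prems]
  have "((\<lambda>x. b * f (c * x)) has_real_derivative b * (deriv f (c * x) * c)) (at x)" for x
    by (intro DERIV_cmult DERIV_chain2[where g = "(*) c"] f'(1)) (auto intro!: derivative_eq_intros)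
  then have "deriv (\<lambda>x. b * f (c * x)) = (\<lambda>x. b * c * deriv f (c * x))"
    by (intro ext) (simp add: DERIV_imp_deriv algebra_simps)
  then show ?case using Suc.IH[OF f'(2), of "b * c"] by (simp add: funpow_swap1 algebra_simps)
qed simp

lemma higher_deriv_eq_of_scaled_sides:
  assumes f: "Cn_on n UNIV f" and g: "Cn_on n UNIV g"
    and left: "\<And>x. x < 0 \<Longrightarrow> g x = b * f (c * x)" and right: "\<And>x. x > 0 \<Longrightarrow> g x = b' * f (c' * x)"
  shows "b * c ^ n * (deriv ^^ n) f 0 = b' * c' ^ n * (deriv ^^ n) f 0"
proof -
  have "(deriv ^^ n) g 0 = (deriv ^^ n) (\<lambda>x. b * f (c * x)) 0"
    by (rule higher_deriv_eq_on_closure[OF g Cn_on_scale[OF f] open_lessThan left]) auto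
  moreover have "(deriv ^^ n) g 0 = (deriv ^^ n) (\<lambda>x. b' * f (c' * x)) 0"
    by (rule higher_deriv_eq_on_closure[OF g Cn_on_scale[OF f] open_greaterThan right]) auto
  ultimately show ?thesis by (simp only: higher_deriv_scale[OF f] mult_zero_right)
qed

lemma Ck_on_cong: "(\<And>x. x \<in> S \<Longrightarrow> f x = g x) \<Longrightarrow> Ck_on k S f \<longleftrightarrow> Ck_on k S g"
  unfolding Ck_on_def using Cn_on_cong by metis

lemma Ck_on_subset: "Ck_on k S f \<Longrightarrow> T \<subseteq> S \<Longrightarrow> Ck_on k T f"
  unfolding Ck_on_def using Cn_on_subset by metis

lemma Ck_on_compose: "f ` S \<subseteq> T \<Longrightarrow> Ck_on k S f \<Longrightarrow> Ck_on k T g \<Longrightarrow> Ck_on k S (g \<circ> f)"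
  unfolding Ck_on_def comp_def using Cn_on_compose by metis

lemma Ck_on_local:
  assumes "\<And>x. x \<in> S \<Longrightarrow> \<exists>T. open T \<and> x \<in> T \<and> T \<subseteq> S \<and> Ck_on k T f"
  shows "Ck_on k S f"
  unfolding Ck_on_def
proof (intro allI impI Cn_on_local)
  fix n x assume "enat n \<le> k" "x \<in> S"
  then show "\<exists>T. open T \<and> x \<in> T \<and> T \<subseteq> S \<and> Cn_on n T f"
    using assms unfolding Ck_on_def by blast
qed

lemma Ck_on_cmult: "Ck_on k S (\<lambda>x. c * x)"
  unfolding Ck_on_def by (auto intro!: Cn_on_mult Cn_on_const Cn_on_id)

lemma Ck_on_id: "Ck_on k S id"
  using Ck_on_cmult[of k S 1] by (simp add: id_def)

lemma Ck_on_imp_continuous_on: "Ck_on k S f \<Longrightarrow> continuous_on S f"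
  by (auto simp: Ck_on_def Cn_on_0 zero_enat_def[symmetric] dest: spec[of _ 0])

section \<open>The topology of the line with two origins\<close>

text \<open>\<open>sheet True\<close> and \<open>sheet False\<close> are the inverses of \<open>id_U\<close> and \<open>id_V\<close>.\<close>

definition sheet :: "bool \<Rightarrow> real \<Rightarrow> L" where
  "sheet s x = (if s \<or> x \<noteq> 0 then Pt x else Org2)"

lemma sheet_True: "sheet True = Pt"
  by (simp add: sheet_def fun_eq_iff)

lemma real_of_L_sheet [simp]: "real_of_L (sheet s x) = x"
  by (simp add: sheet_def)

lemma sheet_cases:
  obtains s x where "p = sheet s x"
proof (cases p)
  case (Pt x)
  then show ?thesis using that[of True x] by (simp add: sheet_def)
next
  case Org2
  then show ?thesis using that[of False 0] by (simp add: sheet_def)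
qed

lemma sheet_eq_iff [simp]: "sheet s x = sheet t y \<longleftrightarrow> x = y \<and> (s = t \<or> x \<noteq> 0)"
  by (auto simp: sheet_def)

lemma sheet_mem_range_iff [simp]: "sheet s x \<in> range (sheet t) \<longleftrightarrow> s = t \<or> x \<noteq> 0"
  by auto

lemma LU_eq_range_sheet: "LU = range (sheet True)" and LV_eq_range_sheet: "LV = range (sheet False)"
proof -
  show "LU = range (sheet True)" by (simp add: LU_def sheet_True)
  have "p \<in> LV \<longleftrightarrow> p \<in> range (sheet False)" for p
    by (cases p rule: sheet_cases) (auto simp: LV_def simp flip: sheet_True)
  then show "LV = range (sheet False)" by blast
qed

lemma Lopen_iff_sheet: "Lopen S \<longleftrightarrow> (\<forall>s. open (sheet s -` S))"
proof -
  have "sheet False -` S = (if Org2 \<in> S then insert 0 (Pt -` S) else Pt -` S - {0})"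
    by (auto simp: sheet_def split: if_splits)
  then have "Lopen S \<longleftrightarrow> open (sheet True -` S) \<and> open (sheet False -` S)"
    by (auto simp: Lopen_def sheet_True open_Diff)
  then show ?thesis by (simp only: all_bool_eq conj_commute)
qed

lemma openin_Ltop: "openin Ltop S \<longleftrightarrow> Lopen S"
  unfolding Ltop_def by (simp add: topology_inverse'[OF istopology_Lopen])

lemma topspace_Ltop [simp]: "topspace Ltop = UNIV"
proof -
  have "openin Ltop UNIV" by (simp add: openin_Ltop Lopen_iff_sheet)
  then show ?thesis using openin_subset by blast
qed

lemma Lopen_Int: "Lopen S \<Longrightarrow> Lopen T \<Longrightarrow> Lopen (S \<inter> T)"
  by (simp add: Lopen_iff_sheet open_Int)

lemma Lopen_range_sheet: "Lopen (range (sheet s))"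
proof -
  have "sheet t -` range (sheet s) = (if t = s then UNIV else - {0})" for t by auto
  then show ?thesis by (auto simp: Lopen_iff_sheet)
qed

lemma continuous_map_Ltop_iff:
  "continuous_map Ltop X f \<longleftrightarrow> f \<in> UNIV \<rightarrow> topspace X \<and> (\<forall>S. openin X S \<longrightarrow> Lopen (f -` S))"
  by (auto simp: continuous_map_def openin_Ltop vimage_def)

lemma Lopen_vimage: "continuous_map Ltop Ltop f \<Longrightarrow> Lopen S \<Longrightarrow> Lopen (f -` S)"
  by (simp add: continuous_map_Ltop_iff openin_Ltop)

lemma continuous_map_real_of_L: "continuous_map Ltop euclideanreal real_of_L"
  by (auto simp: continuous_map_Ltop_iff Lopen_iff_sheet vimage_def)

lemma continuous_map_sheet: "continuous_map euclideanreal Ltop (sheet s)"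
  by (auto simp: continuous_map_def openin_Ltop Lopen_iff_sheet vimage_def)

section \<open>Homeomorphisms of the line with two origins\<close>

definition homeo0 :: "(real \<Rightarrow> real) set" where
  "homeo0 = {h. bij h \<and> h 0 = 0 \<and> continuous_on UNIV h \<and> continuous_on UNIV (inv h)}"

lemma homeo0_0: "h \<in> homeo0 \<Longrightarrow> h 0 = 0"
  by (simp add: homeo0_def)

lemma homeo0_eq_0_iff: "h \<in> homeo0 \<Longrightarrow> h x = 0 \<longleftrightarrow> x = 0"
  using inj_eq[of h x 0] by (auto simp: homeo0_def bij_def)

lemma homeo0_id [simp]: "id \<in> homeo0"
  by (simp add: homeo0_def)

lemma homeo0_inv [simp]: "h \<in> homeo0 \<Longrightarrow> inv h \<in> homeo0"
  unfolding homeo0_def by (auto simp: bij_imp_bij_inv inv_inv_eq inv_f_eq bij_is_inj)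

lemma homeo0_comp [simp]: "g \<in> homeo0 \<Longrightarrow> h \<in> homeo0 \<Longrightarrow> g \<circ> h \<in> homeo0"
  unfolding homeo0_def
  by (auto simp: bij_comp o_inv_distrib intro: continuous_on_compose2[of UNIV])

lemma homeo0_bij: "h \<in> homeo0 \<Longrightarrow> bij h"
  by (simp add: homeo0_def)

lemma homeo0_comp_inv [simp]: "h \<in> homeo0 \<Longrightarrow> h \<circ> inv h = id" "h \<in> homeo0 \<Longrightarrow> inv h \<circ> h = id"
  unfolding homeo0_def bij_def by (auto simp: surj_iff[symmetric])

lemma homeo0_apply_inv [simp]: "h \<in> homeo0 \<Longrightarrow> h (inv h x) = x" "h \<in> homeo0 \<Longrightarrow> inv h (h x) = x"
  by (simp_all add: homeo0_bij bij_is_inj bij_is_surj surj_f_inv_f)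

lemma homeo0_inv_inv [simp]: "h \<in> homeo0 \<Longrightarrow> inv (inv h) = h"
  by (simp add: homeo0_bij inv_inv_eq)

lemma homeo0_inv_comp: "g \<in> homeo0 \<Longrightarrow> h \<in> homeo0 \<Longrightarrow> inv (g \<circ> h) = inv h \<circ> inv g"
  by (simp add: homeo0_bij o_inv_distrib)

lemma not_strict_antimono_if_strict_mono:
  fixes h :: "'a::preorder \<Rightarrow> 'b::preorder"
  assumes "x \<in> S" "y \<in> S" "x < y" "strict_mono_on S h"
  shows "\<not> strict_antimono_on S h"
  using assms monotone_onD[of S "(<)" "(<)" h x y] monotone_onD[of S "(<)" "(>)" h x y]
  by (auto dest: less_asym)

lemma homeo0_strict_antimono_iff:
  assumes "h \<in> homeo0"
  shows "strict_antimono_on UNIV h \<longleftrightarrow> \<not> strict_mono h"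
proof -
  have "strict_mono h \<or> strict_antimono_on UNIV h"
    using assms injective_eq_monotone_map[of UNIV h] by (auto simp: homeo0_def bij_def)
  then show ?thesis using not_strict_antimono_if_strict_mono[of 0 UNIV 1 h] by auto
qed

lemma homeo0_strict_mono_comp_iff:
  assumes "g \<in> homeo0" "h \<in> homeo0"
  shows "strict_mono (g \<circ> h) \<longleftrightarrow> (strict_mono g \<longleftrightarrow> strict_mono h)"
proof -
  have "strict_mono (g \<circ> h)" if "strict_mono g" "strict_mono h"
    using that by (simp add: monotone_on_def)
  moreover have "strict_mono (g \<circ> h)" if "strict_antimono_on UNIV g" "strict_antimono_on UNIV h"
    using that by (simp add: monotone_on_def)
  moreover have "strict_antimono_on UNIV (g \<circ> h)" if "strict_mono g" "strict_antimono_on UNIV h"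
    using that by (simp add: monotone_on_def)
  moreover have "strict_antimono_on UNIV (g \<circ> h)" if "strict_antimono_on UNIV g" "strict_mono h"
    using that by (simp add: monotone_on_def)
  ultimately show ?thesis
    using homeo0_strict_antimono_iff assms homeo0_comp[OF assms] by blast
qed

lemma homeo0_strict_mono_inv_iff:
  assumes "h \<in> homeo0"
  shows "strict_mono (inv h) \<longleftrightarrow> strict_mono h"
  using homeo0_strict_mono_comp_iff[OF assms homeo0_inv[OF assms]] assms
    strict_mono_on_id[of "UNIV :: real set"] by simp

definition lift :: "bool \<Rightarrow> (real \<Rightarrow> real) \<Rightarrow> L \<Rightarrow> L" where
  "lift s h p = sheet (s = (p \<in> range (sheet True))) (h (real_of_L p))"

lemma real_of_L_lift [simp]: "real_of_L (lift s h p) = h (real_of_L p)"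
  by (simp add: lift_def)

definition underlying :: "(L \<Rightarrow> L) \<Rightarrow> real \<Rightarrow> real" where
  "underlying f = real_of_L \<circ> f \<circ> Pt"

lemma underlying_lift [simp]: "underlying (lift s h) = h"
  by (simp add: underlying_def fun_eq_iff)

lemma lift_sheet [simp]: "h \<in> homeo0 \<Longrightarrow> lift s h (sheet t x) = sheet (s = t) (h x)"
  using homeo0_eq_0_iff[of h x] by (auto simp: lift_def)

lemma lift_comp:
  assumes "g \<in> homeo0" "h \<in> homeo0"
  shows "lift s g \<circ> lift t h = lift (s = t) (g \<circ> h)"
proof
  fix p
  obtain r x where "p = sheet r x" by (rule sheet_cases)
  with assms show "(lift s g \<circ> lift t h) p = lift (s = t) (g \<circ> h) p" by auto
qed

lemma lift_id: "lift True id = id"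
proof
  fix p show "lift True id p = id p" by (cases p rule: sheet_cases) simp
qed

lemma lift_eq_iff:
  assumes "g \<in> homeo0" "h \<in> homeo0"
  shows "lift s g = lift t h \<longleftrightarrow> s = t \<and> g = h"
proof
  assume lift: "lift s g = lift t h"
  have "g x = h x \<and> (s = t \<or> g x \<noteq> 0)" for x
    using fun_cong[OF lift, of "sheet True x"] assms by auto
  then show "s = t \<and> g = h" using homeo0_0[OF assms(1)] by blast
qed simp

lemma inv_lift:
  assumes "h \<in> homeo0"
  shows "inv (lift s h) = lift s (inv h)"
  using assms by (intro inv_unique_comp) (simp_all add: lift_comp lift_id)

lemma continuous_map_lift:
  assumes "h \<in> homeo0"
  shows "continuous_map Ltop Ltop (lift s h)"
proof -
  have "sheet t -` lift s h -` S = h -` sheet (s = t) -` S" for t S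
    using assms by auto
  moreover have "open (h -` W)" if "open W" for W
    using assms that by (auto simp: homeo0_def continuous_on_open_vimage)
  ultimately show ?thesis by (auto simp: continuous_map_Ltop_iff openin_Ltop Lopen_iff_sheet)
qed

lemma homeomorphic_map_lift:
  assumes "h \<in> homeo0"
  shows "homeomorphic_map Ltop Ltop (lift s h)"
proof -
  have "homeomorphic_maps Ltop Ltop (lift s h) (lift s (inv h))"
    unfolding homeomorphic_maps_def
    using assms fun_cong[OF lift_comp[of h "inv h" s s]] fun_cong[OF lift_comp[of "inv h" h s s]]
    by (auto simp: lift_id continuous_map_lift)
  then show ?thesis using homeomorphic_map_maps by blast
qed

lemma continuous_map_Hausdorff_origins_eq:
  assumes "Hausdorff_space X" "continuous_map Ltop X q"
  shows "q (Pt 0) = q Org2"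
proof -
  have "(q \<circ> sheet True) 0 = (q \<circ> sheet False) 0"
  proof (rule forall_in_closure_of_eq[where f = "q \<circ> sheet True" and g = "q \<circ> sheet False"])
    show "(0::real) \<in> euclideanreal closure_of {..<0}" by simp
    show "continuous_map euclideanreal X (q \<circ> sheet True)"
      "continuous_map euclideanreal X (q \<circ> sheet False)"
      by (rule continuous_map_compose[OF continuous_map_sheet assms(2)])+
  qed (use assms(1) in \<open>auto simp: sheet_def\<close>)
  then show ?thesis by (simp add: sheet_def)
qed

lemma continuous_injective_L_eq_lift:
  assumes f: "continuous_map Ltop Ltop f" and inj: "inj f"
  obtains s where "f = lift s (underlying f)" "f (Pt 0) \<in> {Pt 0, Org2}"
proof
  have "(real_of_L \<circ> f) (Pt 0) = (real_of_L \<circ> f) Org2"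
    using continuous_map_compose[OF f continuous_map_real_of_L]
    by (rule continuous_map_Hausdorff_origins_eq[rotated]) simp
  then have origins: "f (Pt 0) = Pt 0 \<and> f Org2 = Org2 \<or> f (Pt 0) = Org2 \<and> f Org2 = Pt 0"
    using inj_eq[OF inj, of "Pt 0" Org2] by (cases "f (Pt 0)"; cases "f Org2") auto
  then show "f (Pt 0) \<in> {Pt 0, Org2}" by blast
  show "f = lift (f (Pt 0) = Pt 0) (underlying f)"
  proof
    fix p show "f p = lift (f (Pt 0) = Pt 0) (underlying f) p"
    proof (cases "p \<in> {Pt 0, Org2}")
      case True
      then show ?thesis using origins by (auto simp: lift_def sheet_def underlying_def)
    next
      case False
      then have "f p \<noteq> f (Pt 0)" "f p \<noteq> f Org2" using inj_eq[OF inj] by blast+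
      then show ?thesis
        using origins False by (cases p; cases "f p") (auto simp: lift_def sheet_def underlying_def)
    qed
  qed
qed

lemma homeomorphic_map_L_cases:
  assumes "homeomorphic_map Ltop Ltop f"
  obtains s h where "h \<in> homeo0" "f = lift s h"
proof -
  obtain g where fg: "continuous_map Ltop Ltop f" "continuous_map Ltop Ltop g"
      "\<And>p. g (f p) = p" "\<And>p. f (g p) = p"
    using assms homeomorphic_map_maps[of Ltop Ltop f] by (auto simp: homeomorphic_maps_def)
  define u v where "u = underlying f" and "v = underlying g"
  have "inj f" "inj g" using fg(3,4) by (metis injI)+
  then obtain s t where f: "f = lift s u" "f (Pt 0) \<in> {Pt 0, Org2}" and g: "g = lift t v"
    using continuous_injective_L_eq_lift fg(1,2) unfolding u_def v_def by metis
  have "v (u x) = x" "u (v x) = x" for x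
    using arg_cong[OF fg(3)[of "Pt x"], of real_of_L] arg_cong[OF fg(4)[of "Pt x"], of real_of_L]
    by (simp_all add: f(1) g)
  then have "bij u" "inv u = v" by (auto intro!: o_bij[of v] inv_unique_comp)
  moreover have "u 0 = 0" using f(2) by (auto simp: u_def underlying_def)
  moreover have "continuous_map euclideanreal euclideanreal u"
    "continuous_map euclideanreal euclideanreal v"
    unfolding u_def v_def underlying_def sheet_True[symmetric]
    by (intro continuous_map_compose[OF continuous_map_sheet]
        continuous_map_compose[OF _ continuous_map_real_of_L] fg)+
  ultimately have "u \<in> homeo0" by (simp add: homeo0_def)
  then show thesis using f(1) that by blast
qed

lemma homeomorphic_map_L_inv:
  assumes "homeomorphic_map Ltop Ltop f"
  shows "bij f" "homeomorphic_map Ltop Ltop (inv f)"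
proof -
  obtain s h where h: "h \<in> homeo0" "f = lift s h" using assms by (rule homeomorphic_map_L_cases)
  then show "homeomorphic_map Ltop Ltop (inv f)" by (simp add: inv_lift homeomorphic_map_lift)
  show "bij f" using h by (intro o_bij[of "lift s (inv h)"]) (simp_all add: lift_comp lift_id)
qed

lemma orient_pres_lift: "h \<in> homeo0 \<Longrightarrow> orient_pres (lift s h) \<longleftrightarrow> strict_mono h"
  and orient_rev_lift: "h \<in> homeo0 \<Longrightarrow> orient_rev (lift s h) \<longleftrightarrow> \<not> strict_mono h"
proof -
  assume h: "h \<in> homeo0"
  have "strict_mono h \<Longrightarrow> orient_pres (lift s h)" "strict_antimono_on UNIV h \<Longrightarrow> orient_rev (lift s h)"
    by (auto simp: orient_pres_def orient_rev_def monotone_on_def)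
  moreover have "\<not> (orient_pres (lift s h) \<and> orient_rev (lift s h))"
    using not_strict_antimono_if_strict_mono[of "1 :: real" "- {0}" 2]
    by (auto simp: orient_pres_def orient_rev_def)
  ultimately show "orient_pres (lift s h) \<longleftrightarrow> strict_mono h" "orient_rev (lift s h) \<longleftrightarrow> \<not> strict_mono h"
    using homeo0_strict_antimono_iff[OF h] by blast+
qed

lemma fixes_origins_lift: "h \<in> homeo0 \<Longrightarrow> fixes_origins (lift s h) \<longleftrightarrow> s"
  and exchanges_origins_lift: "h \<in> homeo0 \<Longrightarrow> exchanges_origins (lift s h) \<longleftrightarrow> \<not> s"
  by (auto simp: fixes_origins_def exchanges_origins_def lift_def sheet_def dest: homeo0_0)

section \<open>\<open>C\<^sup>k\<close> maps in charts\<close>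

definition Ck_in_charts :: "enat \<Rightarrow> chart \<Rightarrow> chart \<Rightarrow> (L \<Rightarrow> L) \<Rightarrow> bool" where
  "Ck_in_charts k c d f \<longleftrightarrow>
     Ck_on k (snd c ` (fst c \<inter> f -` fst d)) (snd d \<circ> f \<circ> inv_into (fst c) (snd c))"

lemma Ck_map_iff: "Ck_map k S T f \<longleftrightarrow> (\<forall>c\<in>\<Union>S. \<forall>d\<in>\<Union>T. Ck_in_charts k c d f)"
  unfolding Ck_map_def Ck_in_charts_def by (simp add: case_prod_beta)

lemma Ck_compatible_iff: "Ck_compatible k c d \<longleftrightarrow> Ck_in_charts k c d id"
  unfolding Ck_compatible_def Ck_in_charts_def by (simp add: case_prod_beta)

lemma is_chart_Lopen: "is_chart c \<Longrightarrow> Lopen (fst c)"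
  by (auto simp: is_chart_def)

lemma is_chart_inj_on: "is_chart c \<Longrightarrow> inj_on (snd c) (fst c)"
  by (auto simp: is_chart_def dest: homeomorphic_imp_injective_map)

lemma is_chart_open_image:
  assumes "is_chart c" "Lopen W"
  shows "open (snd c ` (fst c \<inter> W))"
proof -
  have image: "open (snd c ` fst c)"
    and homeo: "homeomorphic_map (subtopology Ltop (fst c))
      (subtopology euclideanreal (snd c ` fst c)) (snd c)"
    using assms(1) by (auto simp: is_chart_def)
  have "openin (subtopology Ltop (fst c)) (fst c \<inter> W)"
    using assms(2) openin_Ltop openin_subtopology_Int2 by blast
  then have "openin (subtopology euclideanreal (snd c ` fst c)) (snd c ` (fst c \<inter> W))"
    using homeomorphic_imp_open_map[OF homeo] by (simp add: open_map_def)
  then show ?thesis using image by (simp add: openin_open_eq)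
qed

lemma Ck_in_charts_comp:
  assumes c: "is_chart c" and d: "is_chart d"
    and f: "continuous_map Ltop Ltop f" and g: "continuous_map Ltop Ltop g"
    and factor: "\<And>p. p \<in> fst c \<Longrightarrow> g (f p) \<in> fst d \<Longrightarrow>
      \<exists>e. is_chart e \<and> f p \<in> fst e \<and> Ck_in_charts k c e f \<and> Ck_in_charts k e d g"
  shows "Ck_in_charts k c d (g \<circ> f)"
  unfolding Ck_in_charts_def
proof (rule Ck_on_local)
  fix y assume "y \<in> snd c ` (fst c \<inter> (g \<circ> f) -` fst d)"
  then obtain p where p: "p \<in> fst c" "g (f p) \<in> fst d" "y = snd c p" by auto
  obtain e where e: "is_chart e" "f p \<in> fst e"
    and Ck_f: "Ck_in_charts k c e f" and Ck_g: "Ck_in_charts k e d g"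
    using factor[OF p(1,2)] by blast
  define W where "W = f -` (fst e \<inter> g -` fst d)"
  let ?T = "snd c ` (fst c \<inter> W)" and ?inv = "\<lambda>c. inv_into (fst c) (snd c)"
  have "Lopen W"
    unfolding W_def by (intro Lopen_vimage[OF f] Lopen_Int Lopen_vimage[OF g] is_chart_Lopen d e)
  then have "open ?T" by (rule is_chart_open_image[OF c])
  note inv = inv_into_f_f[OF is_chart_inj_on[OF c]] inv_into_f_f[OF is_chart_inj_on[OF e(1)]]
  have "Ck_on k ?T (snd e \<circ> f \<circ> ?inv c)"
    using Ck_f unfolding Ck_in_charts_def by (rule Ck_on_subset) (auto simp: W_def)
  then have "Ck_on k ?T ((snd d \<circ> g \<circ> ?inv e) \<circ> (snd e \<circ> f \<circ> ?inv c))"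
    by (rule Ck_on_compose[rotated, OF _ Ck_g[unfolded Ck_in_charts_def]]) (auto simp: W_def inv)
  also have "Ck_on k ?T ((snd d \<circ> g \<circ> ?inv e) \<circ> (snd e \<circ> f \<circ> ?inv c)) \<longleftrightarrow>
      Ck_on k ?T (snd d \<circ> (g \<circ> f) \<circ> ?inv c)"
    by (rule Ck_on_cong) (auto simp: W_def inv)
  finally show "\<exists>T. open T \<and> y \<in> T \<and> T \<subseteq> snd c ` (fst c \<inter> (g \<circ> f) -` fst d) \<and>
      Ck_on k T (snd d \<circ> (g \<circ> f) \<circ> ?inv c)"
    using \<open>open ?T\<close> p e(2) by (intro exI[of _ ?T]) (auto simp: W_def)
qed

lemma Ck_atlas_chart_at:
  assumes "Ck_atlas k A"
  obtains c where "c \<in> A" "p \<in> fst c"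
  using assms unfolding Ck_atlas_def by blast

lemma Ck_map_struct_of_iff:
  assumes A: "Ck_atlas k A" and B: "Ck_atlas k B" and f: "continuous_map Ltop Ltop f"
  shows "Ck_map k (Ck_struct_of k A) (Ck_struct_of k B) f \<longleftrightarrow> (\<forall>c\<in>A. \<forall>d\<in>B. Ck_in_charts k c d f)"
proof
  have "A \<in> Ck_struct_of k A" "B \<in> Ck_struct_of k B"
    using A B by (simp_all add: Ck_struct_of_def)
  then show "Ck_map k (Ck_struct_of k A) (Ck_struct_of k B) f \<Longrightarrow> \<forall>c\<in>A. \<forall>d\<in>B. Ck_in_charts k c d f"
    unfolding Ck_map_iff by blast
next
  assume AB: "\<forall>c\<in>A. \<forall>d\<in>B. Ck_in_charts k c d f"
  have "Ck_in_charts k c d f"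
    if c: "c \<in> A'" "A' \<in> Ck_struct_of k A" and d: "d \<in> B'" "B' \<in> Ck_struct_of k B" for c d A' B'
  proof -
    have chart: "is_chart e" if "e \<in> A \<union> A' \<union> B \<union> B'" for e
      using that c(2) d(2) by (auto simp: Ck_struct_of_def Ck_atlas_def)
    have compat: "Ck_in_charts k e e' id"
      if "e \<in> A \<union> A' \<and> e' \<in> A \<union> A' \<or> e \<in> B \<union> B' \<and> e' \<in> B \<union> B'" for e e'
      using that c(2) d(2) by (auto simp: Ck_struct_of_def Ck_atlas_def Ck_compatible_iff)
    have id: "continuous_map Ltop Ltop id" by simp
    have "Ck_in_charts k e d (id \<circ> f)" if e: "e \<in> A" for e
    proof (rule Ck_in_charts_comp[OF _ _ f id])
      fix p
      obtain e' where "e' \<in> B" "f p \<in> fst e'" using B by (rule Ck_atlas_chart_at)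
      then show "\<exists>e'. is_chart e' \<and> f p \<in> fst e' \<and> Ck_in_charts k e e' f \<and> Ck_in_charts k e' d id"
        using chart compat AB d(1) e by blast
    qed (use chart d(1) e in auto)
    then have to_d: "Ck_in_charts k e d f" if "e \<in> A" for e using that by simp
    have "Ck_in_charts k c d (f \<circ> id)"
    proof (rule Ck_in_charts_comp[OF _ _ id f])
      fix p
      obtain e where "e \<in> A" "id p \<in> fst e" using A by (rule Ck_atlas_chart_at)
      then show "\<exists>e. is_chart e \<and> id p \<in> fst e \<and> Ck_in_charts k c e id \<and> Ck_in_charts k e d f"
        using chart compat to_d c(1) by blast
    qed (use chart c(1) d(1) in auto)
    then show ?thesis by simp
  qed
  then show "Ck_map k (Ck_struct_of k A) (Ck_struct_of k B) f" unfolding Ck_map_iff by blast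
qed

lemma Ck_structure_chart: "is_Ck_structure k S \<Longrightarrow> c \<in> \<Union>S \<Longrightarrow> is_chart c"
  by (auto simp: is_Ck_structure_def Ck_struct_of_def Ck_atlas_def)

lemma Ck_structure_chart_at:
  assumes "is_Ck_structure k S"
  obtains c where "c \<in> \<Union>S" "p \<in> fst c"
proof -
  obtain A where A: "Ck_atlas k A" "S = Ck_struct_of k A"
    using assms by (auto simp: is_Ck_structure_def)
  then have "A \<in> S" by (simp add: Ck_struct_of_def)
  with A(1) that show thesis by (metis Ck_atlas_chart_at UnionI)
qed

lemma Ck_map_comp:
  assumes S: "is_Ck_structure k S" and T: "is_Ck_structure k T" and R: "is_Ck_structure k R"
    and "continuous_map Ltop Ltop f" "continuous_map Ltop Ltop g"
    and f: "Ck_map k S T f" and g: "Ck_map k T R g"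
  shows "Ck_map k S R (g \<circ> f)"
  unfolding Ck_map_iff
proof (intro ballI)
  fix c d assume c: "c \<in> \<Union>S" and d: "d \<in> \<Union>R"
  show "Ck_in_charts k c d (g \<circ> f)"
  proof (rule Ck_in_charts_comp)
    fix p
    obtain e where "e \<in> \<Union>T" "f p \<in> fst e" using T by (rule Ck_structure_chart_at)
    then show "\<exists>e. is_chart e \<and> f p \<in> fst e \<and> Ck_in_charts k c e f \<and> Ck_in_charts k e d g"
      using Ck_structure_chart[OF T] f g c d unfolding Ck_map_iff by blast
  qed (use assms Ck_structure_chart c d in blast)+
qed

lemma Ck_map_id:
  assumes "is_Ck_structure k S"
  shows "Ck_map k S S id"
proof -
  obtain A where "Ck_atlas k A" "S = Ck_struct_of k A"
    using assms by (auto simp: is_Ck_structure_def)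
  then show ?thesis
    by (simp add: Ck_map_struct_of_iff Ck_atlas_def Ck_compatible_iff)
qed

section \<open>The groupoid of diffeomorphisms\<close>

lemma DiffD:
  assumes "f \<in> Diff k S T"
  shows "homeomorphic_map Ltop Ltop f" "Ck_map k S T f" "Ck_map k T S (inv f)"
  using assms by (simp_all add: Diff_def)

lemma id_in_Diff: "is_Ck_structure k S \<Longrightarrow> id \<in> Diff k S S"
  by (simp add: Diff_def Ck_map_id homeomorphic_map_id)

lemma Diff_comp:
  assumes S: "is_Ck_structure k S" and T: "is_Ck_structure k T" and R: "is_Ck_structure k R"
    and f: "f \<in> Diff k S T" and g: "g \<in> Diff k T R"
  shows "g \<circ> f \<in> Diff k S R"
proof -
  note homeo = DiffD(1)[OF f] DiffD(1)[OF g]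
  note inv = homeomorphic_map_L_inv[OF homeo(1)] homeomorphic_map_L_inv[OF homeo(2)]
  have "homeomorphic_map Ltop Ltop (g \<circ> f)" using homeo by (rule homeomorphic_map_compose)
  moreover have "Ck_map k S R (g \<circ> f)"
    using DiffD(2)[OF f] DiffD(2)[OF g] homeo
    by (intro Ck_map_comp[OF S T R] homeomorphic_imp_continuous_map)
  moreover have "Ck_map k R S (inv f \<circ> inv g)"
    using DiffD(3)[OF f] DiffD(3)[OF g] inv
    by (intro Ck_map_comp[OF R T S] homeomorphic_imp_continuous_map)
  ultimately show ?thesis using inv(1,3) by (simp add: Diff_def o_inv_distrib)
qed

lemma Diff_inv:
  assumes "f \<in> Diff k S T"
  shows "inv f \<in> Diff k T S" "inv f \<circ> f = id" "f \<circ> inv f = id"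
proof -
  note inv = homeomorphic_map_L_inv[OF DiffD(1)[OF assms]]
  show "inv f \<in> Diff k T S" using assms inv by (simp add: Diff_def inv_inv_eq)
  show "inv f \<circ> f = id" "f \<circ> inv f = id"
    using inv(1) by (simp_all add: bij_is_inj bij_is_surj surj_iff[symmetric])
qed

lemma lift_in_Diff_sub_iff:
  assumes "h \<in> homeo0"
  shows "lift s h \<in> Diff_sub k p t S T \<longleftrightarrow> lift s h \<in> Diff k S T \<and> strict_mono h = p \<and> s = t"
  using assms
  by (auto simp: Diff_sub_def orient_pres_lift orient_rev_lift
      fixes_origins_lift exchanges_origins_lift)

lemma Diff_subE:
  assumes "f \<in> Diff_sub k p s S T"
  obtains h where "h \<in> homeo0" "f = lift s h" "strict_mono h = p" "f \<in> Diff k S T"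
proof -
  have "f \<in> Diff k S T" using assms by (simp add: Diff_sub_def)
  from DiffD(1)[OF this] obtain t h where h: "h \<in> homeo0" "f = lift t h"
    by (rule homeomorphic_map_L_cases)
  have "f \<in> Diff k S T \<and> strict_mono h = p \<and> t = s"
    using assms unfolding h(2) lift_in_Diff_sub_iff[OF h(1)] .
  with h that show thesis by blast
qed

lemma Diff_sub_subset_Diff: "Diff_sub k p s S T \<subseteq> Diff k S T"
  by (auto simp: Diff_sub_def)

lemma Diff_eq_Union_Diff_sub: "Diff k S T = (\<Union>p s. Diff_sub k p s S T)"
proof (intro equalityI subsetI)
  fix f assume f: "f \<in> Diff k S T"
  obtain s h where h: "h \<in> homeo0" "f = lift s h"
    using DiffD(1)[OF f] by (rule homeomorphic_map_L_cases)
  have "f \<in> Diff_sub k (strict_mono h) s S T"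
    using f unfolding h(2) lift_in_Diff_sub_iff[OF h(1)] by simp
  then show "f \<in> (\<Union>p s. Diff_sub k p s S T)" by blast
qed (use Diff_sub_subset_Diff in blast)

lemma Diff_sub_disjoint:
  assumes "f \<in> Diff_sub k p s S T" "f \<in> Diff_sub k q t S T"
  shows "p = q" "s = t"
proof -
  obtain u where u: "u \<in> homeo0" "f = lift s u" "strict_mono u = p"
    using assms(1) by (rule Diff_subE)
  obtain v where v: "v \<in> homeo0" "f = lift t v" "strict_mono v = q"
    using assms(2) by (rule Diff_subE)
  have "lift s u = lift t v" using u(2)[symmetric] v(2) by (rule trans)
  then have "s = t \<and> u = v" using lift_eq_iff[OF u(1) v(1)] by simp
  then show "p = q" "s = t" using u(3) v(3) by auto
qed

lemma id_in_Diff_sub: "is_Ck_structure k S \<Longrightarrow> id \<in> Diff_sub k True True S S"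
  using lift_in_Diff_sub_iff[OF homeo0_id, of True k True True S S]
  by (simp add: lift_id id_in_Diff strict_mono_on_id)

lemma Diff_sub_comp:
  assumes "is_Ck_structure k S" "is_Ck_structure k T" "is_Ck_structure k R"
    and f: "f \<in> Diff_sub k p s T R" and g: "g \<in> Diff_sub k q t S T"
  shows "f \<circ> g \<in> Diff_sub k (p = q) (s = t) S R"
proof -
  obtain u where u: "u \<in> homeo0" "f = lift s u" "strict_mono u = p" "f \<in> Diff k T R"
    using f by (rule Diff_subE)
  obtain v where v: "v \<in> homeo0" "g = lift t v" "strict_mono v = q" "g \<in> Diff k S T"
    using g by (rule Diff_subE)
  have "f \<circ> g = lift (s = t) (u \<circ> v)" using u v by (simp add: lift_comp)
  moreover have "f \<circ> g \<in> Diff k S R" using Diff_comp[OF assms(1-3) v(4) u(4)] .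
  ultimately show ?thesis
    using lift_in_Diff_sub_iff[of "u \<circ> v"] homeo0_strict_mono_comp_iff[OF u(1) v(1)] u v by simp
qed

lemma Diff_sub_inv:
  assumes "f \<in> Diff_sub k p s S T"
  shows "inv f \<in> Diff_sub k p s T S"
proof -
  obtain h where "h \<in> homeo0" "f = lift s h" "strict_mono h = p" "f \<in> Diff k S T"
    using assms by (rule Diff_subE)
  then show ?thesis
    using Diff_inv(1)[of f k S T] lift_in_Diff_sub_iff[of "inv h"]
    by (simp add: inv_lift homeo0_strict_mono_inv_iff)
qed

lemma bij_betw_comp_Diff_sub:
  assumes S: "is_Ck_structure k S" and T: "is_Ck_structure k T" and R: "is_Ck_structure k R"
    and f: "f \<in> Diff_sub k p s T R"
  shows "bij_betw (\<lambda>g. f \<circ> g) (Diff_sub k q t S T) (Diff_sub k (p = q) (s = t) S R)"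
proof (rule bij_betw_byWitness[where f' = "\<lambda>g. inv f \<circ> g"])
  have "f \<in> Diff k T R" using f Diff_sub_subset_Diff by blast
  then show "\<forall>g\<in>Diff_sub k q t S T. inv f \<circ> (f \<circ> g) = g"
    "\<forall>g\<in>Diff_sub k (p = q) (s = t) S R. f \<circ> (inv f \<circ> g) = g"
    by (simp_all add: Diff_inv flip: comp_assoc)
  show "(\<lambda>g. f \<circ> g) ` Diff_sub k q t S T \<subseteq> Diff_sub k (p = q) (s = t) S R"
    using Diff_sub_comp[OF S T R f] by blast
  have "(p = (p = q)) = q" "(s = (s = t)) = t" by auto
  then show "(\<lambda>g. inv f \<circ> g) ` Diff_sub k (p = q) (s = t) S R \<subseteq> Diff_sub k q t S T"
    using Diff_sub_comp[OF S R T Diff_sub_inv[OF f], where q = "p = q" and t = "s = t"] by auto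
qed

section \<open>Diffeomorphisms of the real line fixing 0\<close>

lemma Dk_iff: "h \<in> Dk k \<longleftrightarrow> h \<in> homeo0 \<and> Ck_on k UNIV h \<and> Ck_on k UNIV (inv h)"
  unfolding Dk_def homeo0_def using Ck_on_imp_continuous_on by auto

lemma Dk_homeo0: "h \<in> Dk k \<Longrightarrow> h \<in> homeo0"
  by (simp add: Dk_iff)

lemma Dk_comp:
  assumes "g \<in> Dk k" "h \<in> Dk k"
  shows "g \<circ> h \<in> Dk k"
  using assms unfolding Dk_iff
  by (auto simp: homeo0_inv_comp simp del: comp_apply intro!: Ck_on_compose[of _ UNIV UNIV])

lemma Dk_inv: "h \<in> Dk k \<Longrightarrow> inv h \<in> Dk k"
  by (simp add: Dk_iff)

lemma Dk_linear:
  assumes "c \<noteq> 0"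
  shows "(\<lambda>x. c * x) \<in> Dk k"
proof -
  have "bij ((*) c)" "inv ((*) c) = (*) (1 / c)"
    using assms by (auto intro!: o_bij[of "(*) (1 / c)"] inv_unique_comp)
  then show ?thesis by (auto simp: Dk_def Ck_on_cmult)
qed

lemma Dk_id: "id \<in> Dk k"
  using Dk_linear[of 1 k] by (simp add: id_def)

lemma Dk_Cn_on: "h \<in> Dk k \<Longrightarrow> enat n \<le> k \<Longrightarrow> Cn_on n UNIV h"
  by (simp add: Dk_def Ck_on_def)

lemma Dk_iff_deriv_nonzero:
  assumes "k \<ge> 1"
  shows "h \<in> Dk k \<longleftrightarrow> h \<in> homeo0 \<and> Ck_on k UNIV h \<and> (\<forall>x. deriv h x \<noteq> 0)"
proof (intro iffI conjI allI)
  assume h: "h \<in> Dk k"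
  then show "h \<in> homeo0" "Ck_on k UNIV h" by (simp_all add: Dk_iff)
  have C1: "Cn_on (Suc 0) UNIV g" if "g \<in> Dk k" for g
    using Dk_Cn_on[OF that, of 1] assms by (simp add: one_enat_def)
  have "((\<lambda>x. inv h (h x)) has_real_derivative deriv (inv h) (h x) * deriv h x) (at x)" for x
    using Cn_on_Suc_imp_deriv(1)[OF open_UNIV C1[OF h]]
      Cn_on_Suc_imp_deriv(1)[OF open_UNIV C1[OF Dk_inv[OF h]]]
    by (intro DERIV_chain2) auto
  moreover have "(\<lambda>x. inv h (h x)) = (\<lambda>x. x)" using Dk_homeo0[OF h] by simp
  ultimately have "deriv (inv h) (h x) * deriv h x = 1" for x
    using DERIV_unique[OF _ DERIV_ident] by metis
  then show "deriv h x \<noteq> 0" for x by (metis mult_zero_right zero_neq_one)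
next
  assume h: "h \<in> homeo0 \<and> Ck_on k UNIV h \<and> (\<forall>x. deriv h x \<noteq> 0)"
  then have "Cn_on n UNIV (inv h)" if "enat n \<le> k" for n
    using that by (intro Cn_on_inv) (auto simp: homeo0_def Ck_on_def)
  with h show "h \<in> Dk k" by (simp add: Dk_iff Ck_on_def)
qed

definition Hk :: "enat \<Rightarrow> (real \<Rightarrow> real) set" where
  "Hk k = {h \<in> homeo0. Ck_on k (- {0}) h \<and> Ck_on k (- {0}) (inv h)}"

lemma Hk_homeo0: "h \<in> Hk k \<Longrightarrow> h \<in> homeo0"
  by (simp add: Hk_def)

lemma homeo0_image_nonzero: "h \<in> homeo0 \<Longrightarrow> h ` (- {0}) \<subseteq> - {0}"
  by (auto simp: homeo0_eq_0_iff)

lemma Hk_comp: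
  assumes "g \<in> Hk k" "h \<in> Hk k"
  shows "g \<circ> h \<in> Hk k"
  using assms unfolding Hk_def
  by (auto simp: homeo0_inv_comp simp del: comp_apply
      intro!: Ck_on_compose[OF homeo0_image_nonzero])

lemma Hk_inv: "h \<in> Hk k \<Longrightarrow> inv h \<in> Hk k"
  by (simp add: Hk_def)

lemma Dk_subset_Hk: "Dk k \<subseteq> Hk k"
  by (auto simp: Dk_iff Hk_def intro: Ck_on_subset)

section \<open>Special minimal atlases\<close>

lemma homeomorphic_maps_chart:
  assumes "homeomorphic_maps (subtopology Ltop U) euclideanreal q r"
  shows "Lopen U \<Longrightarrow> is_chart (U, q)" "q ` (U \<inter> W) = r -` W" "inv_into U q = r"
proof -
  have r: "r x \<in> U" "q (r x) = x" "p \<in> U \<Longrightarrow> r (q p) = p" for x p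
    using assms by (auto simp: homeomorphic_maps_def continuous_map_in_subtopology)
  show "q ` (U \<inter> W) = r -` W"
    using r by (auto simp: image_iff) (metis IntI)
  then show "inv_into U q = r" using r by (intro ext inv_into_f_eq inj_on_inverseI[of U r]) auto
  have "q ` U = UNIV" using r by (metis UNIV_eq_I image_eqI)
  moreover have "homeomorphic_map (subtopology Ltop U) euclideanreal q"
    using assms homeomorphic_map_maps by blast
  ultimately show "Lopen U \<Longrightarrow> is_chart (U, q)" by (simp add: is_chart_def)
qed

definition sheet_chart :: "bool \<Rightarrow> (real \<Rightarrow> real) \<Rightarrow> chart" where
  "sheet_chart s h = (range (sheet s), h \<circ> real_of_L)"

lemma homeomorphic_maps_sheet_chart:
  assumes "h \<in> homeo0"
  shows "homeomorphic_maps (subtopology Ltop (range (sheet s))) euclideanreal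
    (h \<circ> real_of_L) (sheet s \<circ> inv h)"
proof -
  have "continuous_map euclideanreal euclideanreal h"
    "continuous_map euclideanreal euclideanreal (inv h)"
    using assms by (simp_all add: homeo0_def)
  then have "continuous_map Ltop euclideanreal (h \<circ> real_of_L)"
    "continuous_map euclideanreal Ltop (sheet s \<circ> inv h)"
    by (blast intro: continuous_map_compose continuous_map_real_of_L continuous_map_sheet)+
  then show ?thesis
    using assms by (auto simp: homeomorphic_maps_def continuous_map_in_subtopology
        intro: continuous_map_from_subtopology simp del: sheet_mem_range_iff)
qed

lemma is_chart_sheet_chart: "h \<in> homeo0 \<Longrightarrow> is_chart (sheet_chart s h)"
  unfolding sheet_chart_def
  using homeomorphic_maps_chart(1)[OF homeomorphic_maps_sheet_chart] Lopen_range_sheet by blast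

lemma Ck_in_charts_lift_iff:
  assumes "g \<in> homeo0" "h \<in> homeo0" "u \<in> homeo0"
  shows "Ck_in_charts k (sheet_chart t g) (sheet_chart t' h) (lift s u) \<longleftrightarrow>
    Ck_on k (if t' = (s = t) then UNIV else - {0}) (h \<circ> u \<circ> inv g)"
proof -
  have "(sheet t \<circ> inv g) -` lift s u -` range (sheet t') = (if t' = (s = t) then UNIV else - {0})"
    using assms by (auto simp: homeo0_eq_0_iff)
  moreover have "(h \<circ> real_of_L) \<circ> lift s u \<circ> (sheet t \<circ> inv g) = h \<circ> u \<circ> inv g" by auto
  ultimately show ?thesis
    unfolding Ck_in_charts_def sheet_chart_def fst_conv snd_conv
      homeomorphic_maps_chart(2,3)[OF homeomorphic_maps_sheet_chart[OF assms(1)]] by simp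
qed

definition twist :: "bool \<Rightarrow> (real \<Rightarrow> real) \<Rightarrow> real \<Rightarrow> real" where
  "twist s h = (if s then id else h)"

lemma special_atlas_eq: "special_atlas h = range (\<lambda>s. sheet_chart s (twist s h))"
  by (auto simp: special_atlas_def sheet_chart_def twist_def
      LU_eq_range_sheet LV_eq_range_sheet UNIV_bool)

lemma twist_Hk: "h \<in> Hk k \<Longrightarrow> twist s h \<in> Hk k"
  using Dk_id Dk_subset_Hk by (auto simp: twist_def)

lemma Ck_atlas_special_atlas:
  assumes h: "h \<in> Hk k"
  shows "Ck_atlas k (special_atlas h)"
proof -
  note twist = twist_Hk[OF h] and homeo = Hk_homeo0[OF twist_Hk[OF h]]
  have "\<exists>c\<in>special_atlas h. p \<in> fst c" for p
    by (cases p rule: sheet_cases) (auto simp: special_atlas_eq sheet_chart_def)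
  then have "\<Union> (fst ` special_atlas h) = UNIV" by blast
  moreover have "Ck_in_charts k (sheet_chart s (twist s h)) (sheet_chart t (twist t h)) id" for s t
  proof (cases "s = t")
    case True
    then show ?thesis
      using Ck_in_charts_lift_iff[OF homeo homeo homeo0_id, where s = True] homeo
      by (simp add: lift_id Ck_on_id)
  next
    case False
    have "twist t h \<circ> inv (twist s h) \<in> Hk k" by (intro Hk_comp Hk_inv twist)
    then have "Ck_on k (- {0}) (twist t h \<circ> inv (twist s h))" by (simp add: Hk_def)
    with False show ?thesis
      using Ck_in_charts_lift_iff[OF homeo homeo homeo0_id, where s = True] by (simp add: lift_id)
  qed
  ultimately show ?thesis
    using is_chart_sheet_chart[OF homeo]
    by (auto simp: Ck_atlas_def Ck_compatible_iff special_atlas_eq)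
qed

definition special_structure :: "enat \<Rightarrow> (real \<Rightarrow> real) \<Rightarrow> chart set set" where
  "special_structure k h = Ck_struct_of k (special_atlas h)"

lemma is_Ck_structure_special: "h \<in> Hk k \<Longrightarrow> is_Ck_structure k (special_structure k h)"
  unfolding is_Ck_structure_def special_structure_def using Ck_atlas_special_atlas by blast

text \<open>Only the pairs of charts matched by \<open>lift s u\<close> around an origin matter: the representatives in
  the remaining pairs differ from them by maps that are smooth away from \<open>0\<close>.\<close>

lemma Ck_map_lift_iff:
  assumes g: "g \<in> Hk k" and h: "h \<in> Hk k" and u: "u \<in> homeo0"
  shows "Ck_map k (special_structure k g) (special_structure k h) (lift s u) \<longleftrightarrow>
    (\<forall>t. Ck_on k UNIV (twist (s = t) h \<circ> u \<circ> inv (twist t g)))"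
    (is "?Ck_map \<longleftrightarrow> (\<forall>t. Ck_on k UNIV (?rep t))")
proof -
  note homeo = Hk_homeo0[OF twist_Hk[OF g]] Hk_homeo0[OF twist_Hk[OF h]]
  have Ck_map: "?Ck_map \<longleftrightarrow> (\<forall>t t'. Ck_on k (if t' = (s = t) then UNIV else - {0})
      (twist t' h \<circ> u \<circ> inv (twist t g)))"
    unfolding special_structure_def Ck_map_struct_of_iff[OF Ck_atlas_special_atlas[OF g]
        Ck_atlas_special_atlas[OF h] continuous_map_lift[OF u]]
    by (simp add: special_atlas_eq Ck_in_charts_lift_iff[OF homeo u])
  have "Ck_on k (- {0}) (twist t' h \<circ> u \<circ> inv (twist t g))" if "Ck_on k UNIV (?rep t)" for t t'
  proof -
    have "twist t' h \<circ> inv (twist (s = t) h) \<in> Hk k" using h by (intro Hk_comp Hk_inv twist_Hk)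
    then have change: "Ck_on k (- {0}) (twist t' h \<circ> inv (twist (s = t) h))" by (simp add: Hk_def)
    have "?rep t \<in> homeo0" by (intro homeo0_comp homeo0_inv homeo u)
    from Ck_on_compose[OF homeo0_image_nonzero[OF this] Ck_on_subset[OF that] change]
    have "Ck_on k (- {0}) ((twist t' h \<circ> inv (twist (s = t) h)) \<circ> ?rep t)" by simp
    moreover have "(twist t' h \<circ> inv (twist (s = t) h)) \<circ> ?rep t = twist t' h \<circ> u \<circ> inv (twist t g)"
      using homeo(2)[of "s = t"] by (simp add: fun_eq_iff)
    ultimately show ?thesis by simp
  qed
  then show ?thesis unfolding Ck_map by (auto simp del: comp_apply)
qed

lemma lift_in_Diff_iff:
  assumes g: "g \<in> Hk k" and h: "h \<in> Hk k" and u: "u \<in> homeo0"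
  shows "lift s u \<in> Diff k (special_structure k g) (special_structure k h) \<longleftrightarrow>
    (\<forall>t. twist (s = t) h \<circ> u \<circ> inv (twist t g) \<in> Dk k)"
proof -
  note homeo = Hk_homeo0[OF twist_Hk[OF g]] Hk_homeo0[OF twist_Hk[OF h]]
  have "(\<forall>t. P t) \<longleftrightarrow> (\<forall>t. P (s = t))" for P by (cases s) (auto simp: all_bool_eq)
  then have "(\<forall>t. Ck_on k UNIV (twist (s = t) g \<circ> inv u \<circ> inv (twist t h))) \<longleftrightarrow>
      (\<forall>t. Ck_on k UNIV (twist (s = (s = t)) g \<circ> inv u \<circ> inv (twist (s = t) h)))" .
  moreover have "(s = (s = t)) = t" for t by auto
  moreover have "inv (twist (s = t) h \<circ> u \<circ> inv (twist t g)) =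
      twist t g \<circ> inv u \<circ> inv (twist (s = t) h)"
    "twist (s = t) h \<circ> u \<circ> inv (twist t g) \<in> homeo0" for t
    using homeo u by (simp_all add: homeo0_inv_comp comp_assoc)
  ultimately show ?thesis
    by (simp add: Diff_def homeomorphic_map_lift[OF u] inv_lift[OF u] Ck_map_lift_iff[OF g h u]
        Ck_map_lift_iff[OF h g homeo0_inv[OF u]] Dk_iff all_conj_distrib)
qed

lemma lift_True_in_Diff_iff:
  assumes "g \<in> Hk k" "h \<in> Hk k" "u \<in> homeo0"
  shows "lift True u \<in> Diff k (special_structure k g) (special_structure k h) \<longleftrightarrow>
    u \<in> Dk k \<and> h \<circ> u \<circ> inv g \<in> Dk k"
  by (simp add: lift_in_Diff_iff[OF assms] all_bool_eq twist_def)

lemma lift_False_in_Diff_iff: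
  assumes "g \<in> Hk k" "h \<in> Hk k" "u \<in> homeo0"
  shows "lift False u \<in> Diff k (special_structure k g) (special_structure k h) \<longleftrightarrow>
    h \<circ> u \<in> Dk k \<and> u \<circ> inv g \<in> Dk k"
  by (simp add: lift_in_Diff_iff[OF assms] all_bool_eq twist_def)

section \<open>The structures \<open>S_a\<close>\<close>

lemma w_0: "w a 0 = 0"
  by (simp add: w_def)

lemma w_1: "w 1 = id"
  by (auto simp: w_def)

lemma w_inverse: "a > 0 \<Longrightarrow> w a \<circ> w (1 / a) = id" "a > 0 \<Longrightarrow> w (1 / a) \<circ> w a = id"
  by (auto simp: w_def fun_eq_iff mult_le_0_iff divide_le_0_iff)

lemma inv_w: "a > 0 \<Longrightarrow> inv (w a) = w (1 / a)"
  by (rule inv_unique_comp) (simp_all add: w_inverse)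

lemma strict_mono_w: "a > 0 \<Longrightarrow> strict_mono (w a)"
  by (auto simp: strict_mono_def w_def intro: order.strict_trans1 mult_pos_pos)

lemma continuous_on_w: "continuous_on S (w a)"
proof -
  have "w a = (\<lambda>x. min x 0 + a * max x 0)" by (auto simp: w_def)
  then show ?thesis by (auto intro!: continuous_intros)
qed

lemma w_homeo0: "a > 0 \<Longrightarrow> w a \<in> homeo0"
  using o_bij[OF w_inverse(2,1)[of a]] by (simp add: homeo0_def inv_w continuous_on_w w_0)

lemma Ck_on_w: "Ck_on k (- {0}) (w a)"
proof (rule Ck_on_local)
  fix x :: real assume "x \<in> - {0}"
  then consider "x \<in> {..<0}" | "x \<in> {0<..}" by force
  moreover have "Ck_on k {..<0} (w a)" "Ck_on k {0<..} (w a)"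
    using Ck_on_id[of k "{..<0}"] Ck_on_cmult[of k "{0<..}" a]
    by (auto simp: w_def elim!: Ck_on_cong[THEN iffD1, rotated])
  moreover have "{..<0::real} \<subseteq> - {0}" "{0::real<..} \<subseteq> - {0}" by auto
  ultimately show "\<exists>T. open T \<and> x \<in> T \<and> T \<subseteq> - {0} \<and> Ck_on k T (w a)"
    using open_lessThan open_greaterThan by metis
qed

lemma w_Hk: "a > 0 \<Longrightarrow> w a \<in> Hk k"
  by (simp add: Hk_def w_homeo0 inv_w Ck_on_w)

lemma S_a_eq: "S_a k a = special_structure k (w a)"
  by (simp add: S_a_def special_structure_def)

lemma is_Ck_structure_S_a: "a > 0 \<Longrightarrow> is_Ck_structure k (S_a k a)"
  by (simp add: S_a_eq is_Ck_structure_special w_Hk)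

lemma w_comp_strict_mono:
  assumes "u 0 = 0" "strict_mono u" "c > 0"
  shows "w b \<circ> u \<circ> w c = (\<lambda>x. if x \<le> 0 then u x else b * u (c * x))"
proof
  fix x
  have "u y \<le> 0 \<longleftrightarrow> y \<le> 0" for y
    using strict_mono_less_eq[OF assms(2), of y 0] assms(1) by simp
  then show "(w b \<circ> u \<circ> w c) x = (if x \<le> 0 then u x else b * u (c * x))"
    using assms(3) by (simp add: w_def mult_le_0_iff)
qed

lemma w_comp_strict_antimono:
  assumes "u 0 = 0" "strict_antimono_on UNIV u" "c > 0"
  shows "w b \<circ> u \<circ> w c = (\<lambda>x. if x \<le> 0 then b * u x else u (c * x))"
proof
  fix x
  have "u y \<le> 0 \<longleftrightarrow> 0 \<le> y" for y
    using monotone_onD[OF assms(2), of y 0] monotone_onD[OF assms(2), of 0 y] assms(1)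
    by (cases y "0::real" rule: linorder_cases) auto
  then show "(w b \<circ> u \<circ> w c) x = (if x \<le> 0 then b * u x else u (c * x))"
    using assms(1,3) by (auto simp: w_def zero_le_mult_iff)
qed

lemma w_comp_in_Dk_imp_slopes_eq:
  assumes k: "k \<ge> 1" and c: "c > 0" and u: "u \<in> Dk k" and wu: "w b \<circ> u \<circ> w c \<in> Dk k"
  shows "if strict_mono u then b * c = 1 else b = c"
proof -
  have "enat 1 \<le> k" using k by (simp add: one_enat_def)
  then have C1: "Cn_on 1 UNIV u" "Cn_on 1 UNIV (w b \<circ> u \<circ> w c)" using u wu Dk_Cn_on by blast+
  have "u 0 = 0" using Dk_homeo0[OF u] by (rule homeo0_0)
  have "deriv u 0 \<noteq> 0" using u Dk_iff_deriv_nonzero[OF k] by blast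
  show ?thesis
  proof (cases "strict_mono u")
    case True
    have "1 * 1 ^ 1 * (deriv ^^ 1) u 0 = b * c ^ 1 * (deriv ^^ 1) u 0"
      by (rule higher_deriv_eq_of_scaled_sides[OF C1])
        (simp_all add: w_comp_strict_mono[OF \<open>u 0 = 0\<close> True c] del: comp_apply)
    with True \<open>deriv u 0 \<noteq> 0\<close> show ?thesis by simp
  next
    case False
    then have antimono: "strict_antimono_on UNIV u"
      using homeo0_strict_antimono_iff Dk_homeo0[OF u] by blast
    have "b * 1 ^ 1 * (deriv ^^ 1) u 0 = 1 * c ^ 1 * (deriv ^^ 1) u 0"
      by (rule higher_deriv_eq_of_scaled_sides[OF C1])
        (simp_all add: w_comp_strict_antimono[OF \<open>u 0 = 0\<close> antimono c] del: comp_apply)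
    with False \<open>deriv u 0 \<noteq> 0\<close> show ?thesis by simp
  qed
qed

lemma w_conj_in_Dk_imp_Ek_plus:
  assumes a: "a > 0" "a \<noteq> 1" and u: "u \<in> Dk_plus k" and wu: "w a \<circ> u \<circ> w (1 / a) \<in> Dk k"
  shows "u \<in> Ek_plus k"
proof -
  have uD: "u \<in> Dk k" "strict_mono u" "u 0 = 0" using u by (simp_all add: Dk_plus_def Dk_def)
  have "(deriv ^^ i) u 0 = 0" if i: "2 \<le> i" "enat i \<le> k" for i
  proof -
    have "1 * 1 ^ i * (deriv ^^ i) u 0 = a * (1 / a) ^ i * (deriv ^^ i) u 0"
      using a(1)
      by (intro higher_deriv_eq_of_scaled_sides[OF Dk_Cn_on[OF uD(1) i(2)] Dk_Cn_on[OF wu i(2)]])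
        (simp_all add: w_comp_strict_mono[OF uD(3,2)] del: comp_apply)
    moreover have "a * (1 / a) ^ i \<noteq> 1"
    proof
      obtain j where j: "i = Suc j" "j > 0" using i(1) by (cases i) auto
      assume "a * (1 / a) ^ i = 1"
      then have "a ^ j = 1 ^ j" using a(1) j(1) by (simp add: power_divide)
      then show False using power_eq_imp_eq_base[of a j 1] a j(2) by simp
    qed
    ultimately show ?thesis by simp
  qed
  then show ?thesis using u by (simp add: Ek_plus_def)
qed

lemma Ek_plusD:
  assumes "u \<in> Ek_plus k"
  shows "u \<in> Dk k" "strict_mono u" "u 0 = 0"
  using assms by (simp_all add: Ek_plus_def Dk_plus_def Dk_def)

text \<open>The derivatives at \<open>0\<close> of the two halves \<open>u x\<close> and \<open>a u (x / a)\<close> agree: the first ones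
  because the factors cancel, the higher ones because they vanish.\<close>

lemma Ek_plus_imp_Ck_on_w_conj:
  assumes a: "a > 0" and u: "u \<in> Ek_plus k"
  shows "Ck_on k UNIV (w a \<circ> u \<circ> w (1 / a))"
  unfolding Ck_on_def
proof (intro allI impI)
  fix n assume n: "enat n \<le> k"
  have halves: "w a \<circ> u \<circ> w (1 / a) = (\<lambda>x. if x \<le> 0 then u x else a * u (1 / a * x))"
    using a by (intro w_comp_strict_mono Ek_plusD[OF u]) simp
  have Cn: "Cn_on i UNIV u" if "i \<le> n" for i
    using Dk_Cn_on[OF Ek_plusD(1)[OF u] n] that by (rule Cn_on_mono)
  show "Cn_on n UNIV (w a \<circ> u \<circ> w (1 / a))"
    unfolding halves
  proof (rule Cn_on_glue[OF Cn Cn_on_scale[OF Cn]])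
    fix i assume i: "i \<le> n"
    consider "i = 0" | "i = 1" | "2 \<le> i" by linarith
    then have "(deriv ^^ i) u 0 = a * (1 / a) ^ i * (deriv ^^ i) u 0"
    proof cases
      assume "2 \<le> i"
      then have "(deriv ^^ i) u 0 = 0"
        using u i n order_trans[of "enat i" "enat n" k] by (simp add: Ek_plus_def)
      then show ?thesis by simp
    qed (use a Ek_plusD(3)[OF u] in simp_all)
    then show "(deriv ^^ i) u 0 = (deriv ^^ i) (\<lambda>x. a * u (1 / a * x)) 0"
      by (simp only: higher_deriv_scale[OF Cn[OF i]] mult_zero_right)
  qed simp_all
qed

lemma deriv_w_conj_nonzero:
  assumes k: "k \<ge> 1" and a: "a > 0" and u: "u \<in> Dk k" "strict_mono u" "u 0 = 0"
    and Ck: "Ck_on k UNIV (w a \<circ> u \<circ> w (1 / a))"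
  shows "deriv (w a \<circ> u \<circ> w (1 / a)) x \<noteq> 0"
proof -
  let ?g = "w a \<circ> u \<circ> w (1 / a)"
  have halves: "?g = (\<lambda>x. if x \<le> 0 then u x else a * u (1 / a * x))"
    using a by (intro w_comp_strict_mono u) simp
  have "enat 1 \<le> k" using k by (simp add: one_enat_def)
  then have C1: "Cn_on 1 UNIV u" "Cn_on 1 UNIV ?g"
    using Dk_Cn_on[OF u(1)] Ck by (simp_all add: Ck_on_def)
  have deriv_u: "deriv u y \<noteq> 0" for y using u(1) Dk_iff_deriv_nonzero[OF k] by blast
  show ?thesis
  proof (cases "x \<le> 0")
    case True
    have "(deriv ^^ 1) ?g x = (deriv ^^ 1) u x"
      by (rule higher_deriv_eq_on_closure[OF C1(2,1) open_lessThan[of 0]])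
        (use True in \<open>simp_all add: halves del: comp_apply\<close>)
    then show ?thesis using deriv_u by simp
  next
    case False
    have "(deriv ^^ 1) ?g x = (deriv ^^ 1) (\<lambda>x. a * u (1 / a * x)) x"
      by (rule higher_deriv_eq_on_closure[OF C1(2) Cn_on_scale[OF C1(1)] open_greaterThan[of 0]])
        (use False in \<open>simp_all add: halves del: comp_apply\<close>)
    then show ?thesis
      unfolding higher_deriv_scale[OF C1(1)] using deriv_u a by simp
  qed
qed

lemma Ek_plus_imp_w_conj_in_Dk:
  assumes k: "k \<ge> 1" and a: "a > 0" and u: "u \<in> Ek_plus k"
  shows "w a \<circ> u \<circ> w (1 / a) \<in> Dk k"
  unfolding Dk_iff_deriv_nonzero[OF k]
proof (intro conjI allI)
  show "w a \<circ> u \<circ> w (1 / a) \<in> homeo0"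
    using a Dk_homeo0[OF Ek_plusD(1)[OF u]] by (intro homeo0_comp w_homeo0) simp_all
  show Ck: "Ck_on k UNIV (w a \<circ> u \<circ> w (1 / a))" using a u by (rule Ek_plus_imp_Ck_on_w_conj)
  show "deriv (w a \<circ> u \<circ> w (1 / a)) x \<noteq> 0" for x
    using Ek_plusD[OF u] Ck by (rule deriv_w_conj_nonzero[OF k a])
qed

lemma lift_True_in_Diff_S_a_iff:
  assumes "a > 0" "b > 0" "u \<in> homeo0"
  shows "lift True u \<in> Diff k (S_a k a) (S_a k b) \<longleftrightarrow> u \<in> Dk k \<and> w b \<circ> u \<circ> w (1 / a) \<in> Dk k"
  unfolding S_a_eq inv_w[OF assms(1), symmetric]
  by (intro lift_True_in_Diff_iff w_Hk assms)

lemma lift_False_in_Diff_S_a_iff: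
  assumes "a > 0" "b > 0" "u \<in> homeo0"
  shows "lift False u \<in> Diff k (S_a k a) (S_a k b) \<longleftrightarrow> w b \<circ> u \<in> Dk k \<and> u \<circ> w (1 / a) \<in> Dk k"
  unfolding S_a_eq inv_w[OF assms(1), symmetric]
  by (intro lift_False_in_Diff_iff w_Hk assms)

lemma lift_w_in_Diff_sub:
  assumes "a > 0"
  shows "lift False (w a) \<in> Diff_sub k True False (S_a k a) (S_a k (1 / a))"
  using assms
  by (simp add: lift_in_Diff_sub_iff lift_False_in_Diff_S_a_iff w_homeo0 strict_mono_w w_inverse Dk_id)

lemma Diff_sub_S_a_imp_slope:
  assumes k: "k \<ge> 1" and a: "a > 0" and b: "b > 0" and f: "f \<in> Diff_sub k p s (S_a k a) (S_a k b)"
  shows "a = (if p = s then b else 1 / b)"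
proof -
  have fix_origins: "a = (if p then c else 1 / c)"
    if "c > 0" and g: "g \<in> Diff_sub k p True (S_a k a) (S_a k c)" for c g
  proof -
    obtain u where u: "u \<in> homeo0" "g = lift True u" "strict_mono u = p"
      "g \<in> Diff k (S_a k a) (S_a k c)"
      using g by (rule Diff_subE)
    then have "u \<in> Dk k" "w c \<circ> u \<circ> w (1 / a) \<in> Dk k"
      using lift_True_in_Diff_S_a_iff[OF a \<open>c > 0\<close> u(1)] by simp_all
    from w_comp_in_Dk_imp_slopes_eq[OF k _ this] show ?thesis
      using a \<open>c > 0\<close> u(3) by (auto simp: field_simps split: if_splits)
  qed
  show ?thesis
  proof (cases s)
    case True
    then show ?thesis using fix_origins[OF b] f by simp
  next
    case False
    have inverse_pos: "1 / b > 0" using b by simp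
    note structures = is_Ck_structure_S_a[OF a] is_Ck_structure_S_a[OF b]
      is_Ck_structure_S_a[OF inverse_pos]
    have "lift False (w b) \<circ> f \<in> Diff_sub k p True (S_a k a) (S_a k (1 / b))"
      using Diff_sub_comp[OF structures lift_w_in_Diff_sub[OF b] f] False by simp
    from fix_origins[OF inverse_pos this] False show ?thesis by simp
  qed
qed

lemma Diff_sub_S_a_eq_lift_Ek_plus:
  assumes k: "k \<ge> 1" and a: "a > 0" "a \<noteq> 1"
  shows "Diff_sub k True True (S_a k a) (S_a k a) = lift True ` Ek_plus k"
proof (intro equalityI subsetI)
  fix f assume "f \<in> Diff_sub k True True (S_a k a) (S_a k a)"
  then obtain u where u: "u \<in> homeo0" "f = lift True u" "strict_mono u"
    "f \<in> Diff k (S_a k a) (S_a k a)"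
    by (rule Diff_subE) simp
  then show "f \<in> lift True ` Ek_plus k"
    using w_conj_in_Dk_imp_Ek_plus[OF a] by (auto simp: lift_True_in_Diff_S_a_iff a(1) Dk_plus_def)
next
  fix f assume "f \<in> lift True ` Ek_plus k"
  then obtain u where u: "f = lift True u" "u \<in> Ek_plus k" by blast
  then have "u \<in> Dk k" "strict_mono u" using Ek_plusD by blast+
  then show "f \<in> Diff_sub k True True (S_a k a) (S_a k a)"
    using u Ek_plus_imp_w_conj_in_Dk[OF k a(1) u(2)] Dk_homeo0
    by (simp add: lift_in_Diff_sub_iff lift_True_in_Diff_S_a_iff a(1))
qed

text \<open>The factor \<open>sqrt a\<close> balances the two slopes: in the charts around the origins, the involution is
  linear.\<close>

definition flip :: "real \<Rightarrow> real \<Rightarrow> real" where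
  "flip a = w (1 / a) \<circ> (\<lambda>x. - sqrt a * x)"

lemma
  assumes a: "a > 0"
  shows flip_homeo0: "flip a \<in> homeo0"
    and flip_comp_flip: "flip a \<circ> flip a = id"
    and not_strict_mono_flip: "\<not> strict_mono (flip a)"
proof -
  let ?reflect = "\<lambda>x. - sqrt a * x"
  have inverse_pos: "1 / a > 0" using a by simp
  have reflection: "?reflect \<in> homeo0" "strict_antimono_on UNIV ?reflect"
    using a Dk_homeo0[OF Dk_linear[of "- sqrt a"]] by (auto simp: monotone_on_def)
  show "flip a \<in> homeo0" using reflection(1) w_homeo0[OF inverse_pos] by (simp add: flip_def)
  show "\<not> strict_mono (flip a)"
    using homeo0_strict_mono_comp_iff[OF w_homeo0[OF inverse_pos] reflection(1)]
      strict_mono_w[OF inverse_pos] homeo0_strict_antimono_iff[OF reflection(1)] reflection(2)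
    by (simp add: flip_def)
  have "w (1 / a) \<circ> ?reflect \<circ> w (1 / a) =
      (\<lambda>x. if x \<le> 0 then 1 / a * ?reflect x else ?reflect (1 / a * x))"
    by (rule w_comp_strict_antimono[OF _ reflection(2) inverse_pos]) simp
  also have "\<dots> = (\<lambda>x. - (sqrt a / a) * x)" by (simp add: fun_eq_iff)
  finally have "flip a \<circ> flip a = (\<lambda>x. - (sqrt a / a) * x) \<circ> ?reflect"
    by (simp add: flip_def flip: comp_assoc)
  also have "\<dots> = id" using a by (simp add: fun_eq_iff flip: mult.assoc)
  finally show "flip a \<circ> flip a = id" .
qed

lemma lift_flip_in_Diff_sub:
  assumes a: "a > 0"
  shows "lift False (flip a) \<in> Diff_sub k False False (S_a k a) (S_a k a)"
proof -
  have "w a \<circ> flip a = (\<lambda>x. - sqrt a * x)"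
    using w_inverse(1)[OF a] by (simp add: flip_def flip: comp_assoc)
  then have linear: "w a \<circ> flip a \<in> Dk k" using a Dk_linear[of "- sqrt a"] by simp
  have "inv (w a \<circ> flip a) = inv (flip a) \<circ> inv (w a)"
    using a by (intro homeo0_inv_comp w_homeo0 flip_homeo0)
  also have "\<dots> = flip a \<circ> w (1 / a)"
    using a by (simp add: inv_w inv_unique_comp[OF flip_comp_flip flip_comp_flip])
  finally show ?thesis
    using a linear Dk_inv[OF linear]
    by (simp add: lift_in_Diff_sub_iff lift_False_in_Diff_S_a_iff flip_homeo0 not_strict_mono_flip)
qed

lemma lift_flip_involution: "a > 0 \<Longrightarrow> lift False (flip a) \<circ> lift False (flip a) = id"
  by (simp add: lift_comp flip_homeo0 flip_comp_flip lift_id)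

section \<open>Diffeomorphism groups of the structures \<open>S_a\<close>\<close>

lemma Diff_S_1_eq: "Diff k (S_a k 1) (S_a k 1) = {lift s h | s h. h \<in> Dk k}"
proof (intro equalityI subsetI)
  have iff: "lift s h \<in> Diff k (S_a k 1) (S_a k 1) \<longleftrightarrow> h \<in> Dk k" if "h \<in> homeo0" for s h
    using that lift_True_in_Diff_S_a_iff[of 1 1 h k] lift_False_in_Diff_S_a_iff[of 1 1 h k]
    by (cases s) (simp_all add: w_1)
  fix f
  show "f \<in> Diff k (S_a k 1) (S_a k 1)" if "f \<in> {lift s h | s h. h \<in> Dk k}"
    using that iff Dk_homeo0 by blast
  assume f: "f \<in> Diff k (S_a k 1) (S_a k 1)"
  obtain s h where h: "h \<in> homeo0" "f = lift s h"
    using DiffD(1)[OF f] by (rule homeomorphic_map_L_cases)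
  with f iff show "f \<in> {lift s h | s h. h \<in> Dk k}" by auto
qed

lemma Diff_sub_S_1_eq:
  "Diff_sub k p s (S_a k 1) (S_a k 1) = lift s ` (if p then Dk_plus k else Dk_minus k)"
proof -
  have "(if p then Dk_plus k else Dk_minus k) = {h \<in> Dk k. strict_mono h = p}"
    using homeo0_strict_antimono_iff Dk_homeo0 by (auto simp: Dk_plus_def Dk_minus_def)
  moreover have "f \<in> Diff_sub k p s (S_a k 1) (S_a k 1) \<longleftrightarrow>
      f \<in> lift s ` {h \<in> Dk k. strict_mono h = p}"
    if "f = lift t h" "h \<in> Dk k" for f t h
    using that lift_in_Diff_sub_iff[OF Dk_homeo0[OF that(2)]] Diff_S_1_eq lift_eq_iff Dk_homeo0
    by (auto simp: image_iff)
  ultimately show ?thesis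
    using Diff_sub_subset_Diff[of k p s "S_a k 1" "S_a k 1"] unfolding Diff_S_1_eq by auto
qed

lemma Diff_S_1_iso:
  "\<exists>\<eta> :: (L \<Rightarrow> L) \<Rightarrow> (real \<Rightarrow> real) \<times> int.
      bij_betw \<eta> (Diff k (S_a k 1) (S_a k 1)) (Dk k \<times> Z2) \<and>
      (\<forall>f\<in>Diff k (S_a k 1) (S_a k 1). \<forall>g\<in>Diff k (S_a k 1) (S_a k 1).
         \<eta> (f \<circ> g) = (fst (\<eta> f) \<circ> fst (\<eta> g), snd (\<eta> f) * snd (\<eta> g))) \<and>
      \<eta> ` Diff_sub k True True (S_a k 1) (S_a k 1) = Dk_plus k \<times> {1} \<and>
      \<eta> ` Diff_sub k False True (S_a k 1) (S_a k 1) = Dk_minus k \<times> {1} \<and>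
      \<eta> ` Diff_sub k True False (S_a k 1) (S_a k 1) = Dk_plus k \<times> {-1} \<and>
      \<eta> ` Diff_sub k False False (S_a k 1) (S_a k 1) = Dk_minus k \<times> {-1}"
proof -
  define \<eta> :: "(L \<Rightarrow> L) \<Rightarrow> (real \<Rightarrow> real) \<times> int"
    where "\<eta> f = (underlying f, if f Org2 \<in> range (sheet False) then 1 else -1)" for f
  have \<eta>: "\<eta> (lift s h) = (h, if s then 1 else -1)" if "h \<in> homeo0" for s h
    using lift_sheet[OF that, of s False 0] homeo0_0[OF that] by (auto simp: \<eta>_def sheet_def)
  have "bij_betw \<eta> (Diff k (S_a k 1) (S_a k 1)) (Dk k \<times> Z2)"
    unfolding Diff_S_1_eq
    by (rule bij_betw_byWitness[where f' = "\<lambda>(h, e). lift (e = 1) h"])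
      (auto simp: \<eta> Dk_homeo0 Z2_def)
  moreover have "\<forall>f\<in>Diff k (S_a k 1) (S_a k 1). \<forall>g\<in>Diff k (S_a k 1) (S_a k 1).
      \<eta> (f \<circ> g) = (fst (\<eta> f) \<circ> fst (\<eta> g), snd (\<eta> f) * snd (\<eta> g))"
    unfolding Diff_S_1_eq by (auto simp: \<eta> lift_comp Dk_homeo0 Dk_comp simp del: comp_apply)
  moreover have "\<eta> ` lift s ` H = H \<times> {if s then 1 else -1}" if "H \<subseteq> Dk k" for s H
  proof -
    have "\<eta> ` lift s ` H = (\<lambda>h. (h, if s then 1 else -1)) ` H"
      unfolding image_image using that Dk_homeo0 by (intro image_cong \<eta>) auto
    then show ?thesis by auto
  qed
  moreover have "Dk_plus k \<subseteq> Dk k" "Dk_minus k \<subseteq> Dk k" by (auto simp: Dk_plus_def Dk_minus_def)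
  ultimately show ?thesis by (intro exI[of _ \<eta>]) (simp add: Diff_sub_S_1_eq)
qed

lemma Diff_sub_S_a_empty:
  assumes "k \<ge> 1" "a > 0" "b > 0" "a \<noteq> (if p = s then b else 1 / b)"
  shows "Diff_sub k p s (S_a k a) (S_a k b) = {}"
  using Diff_sub_S_a_imp_slope[OF assms(1-3)] assms(4) by blast

lemma Diff_eq_Un_if_Diff_sub_empty:
  assumes "\<And>p s. (p = s) \<noteq> r \<Longrightarrow> Diff_sub k p s S T = {}"
  shows "Diff k S T = Diff_sub k True r S T \<union> Diff_sub k False (\<not> r) S T"
proof
  show "Diff_sub k True r S T \<union> Diff_sub k False (\<not> r) S T \<subseteq> Diff k S T"
    using Diff_sub_subset_Diff by blast
  have "Diff_sub k p s S T \<subseteq> Diff_sub k True r S T \<union> Diff_sub k False (\<not> r) S T" for p s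
    using assms[of p s] by (cases p; cases s; cases r) auto
  then show "Diff k S T \<subseteq> Diff_sub k True r S T \<union> Diff_sub k False (\<not> r) S T"
    unfolding Diff_eq_Union_Diff_sub[of k S T] by blast
qed

lemma neq_inverse:
  fixes a :: real
  assumes "a > 0" "a \<noteq> 1"
  shows "a \<noteq> 1 / a"
proof
  assume "a = 1 / a"
  then have "a\<^sup>2 = 1\<^sup>2" using assms by (simp add: power2_eq_square field_simps)
  then show False using assms power2_eq_imp_eq[of a 1] by simp
qed

lemma Diff_S_a_decomposition:
  assumes "k \<ge> 1" "a > 0" "a \<noteq> 1"
  shows "Diff_sub k True False (S_a k a) (S_a k a) = {}"
    "Diff_sub k False True (S_a k a) (S_a k a) = {}"
    "Diff k (S_a k a) (S_a k a) =
      Diff_sub k True True (S_a k a) (S_a k a) \<union> Diff_sub k False False (S_a k a) (S_a k a)"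
    "Diff_sub k True True (S_a k a) (S_a k a) \<inter> Diff_sub k False False (S_a k a) (S_a k a) = {}"
proof -
  have empty: "Diff_sub k p s (S_a k a) (S_a k a) = {}" if "(p = s) \<noteq> True" for p s
    using Diff_sub_S_a_empty[OF assms(1,2,2)] neq_inverse[OF assms(2,3)] that by simp
  then show "Diff_sub k True False (S_a k a) (S_a k a) = {}"
    "Diff_sub k False True (S_a k a) (S_a k a) = {}" by blast+
  show "Diff k (S_a k a) (S_a k a) =
      Diff_sub k True True (S_a k a) (S_a k a) \<union> Diff_sub k False False (S_a k a) (S_a k a)"
    using Diff_eq_Un_if_Diff_sub_empty[OF empty] by simp
qed (use Diff_sub_disjoint(1) in blast)

lemma Diff_sub_iso_Ek_plus:
  assumes "k \<ge> 1" "a > 0" "a \<noteq> 1"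
  shows "\<exists>\<psi> :: (L \<Rightarrow> L) \<Rightarrow> (real \<Rightarrow> real).
        bij_betw \<psi> (Diff_sub k True True (S_a k a) (S_a k a)) (Ek_plus k) \<and>
        (\<forall>f\<in>Diff_sub k True True (S_a k a) (S_a k a). \<forall>g\<in>Diff_sub k True True (S_a k a) (S_a k a).
           \<psi> (f \<circ> g) = \<psi> f \<circ> \<psi> g)"
  unfolding Diff_sub_S_a_eq_lift_Ek_plus[OF assms]
proof (intro exI[of _ underlying] conjI ballI)
  show "bij_betw underlying (lift True ` Ek_plus k) (Ek_plus k)"
    by (rule bij_betw_byWitness[where f' = "lift True"]) auto
  have "Ek_plus k \<subseteq> homeo0" using Dk_homeo0 Ek_plusD(1) by blast
  then show "underlying (f \<circ> g) = underlying f \<circ> underlying g"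
    if "f \<in> lift True ` Ek_plus k" "g \<in> lift True ` Ek_plus k" for f g
    using that by (auto simp: lift_comp subset_iff simp del: comp_apply)
qed

lemma Diff_eq_cosets_of_involution:
  assumes S: "is_Ck_structure k S"
    and split: "Diff k S S = Diff_sub k True True S S \<union> Diff_sub k False False S S"
    and p: "p \<in> Diff_sub k False False S S" "p \<circ> p = id"
  shows "Diff k S S = {n \<circ> q | n q. n \<in> Diff_sub k True True S S \<and> q \<in> {id, p}}"
proof -
  note comp = Diff_sub_comp[OF S S S]
  show ?thesis
  proof (intro equalityI subsetI)
    fix f assume "f \<in> Diff k S S"
    then consider "f \<in> Diff_sub k True True S S" | "f \<in> Diff_sub k False False S S"
      using split by blast
    then show "f \<in> {n \<circ> q | n q. n \<in> Diff_sub k True True S S \<and> q \<in> {id, p}}"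
    proof cases
      assume "f \<in> Diff_sub k True True S S"
      moreover have "f = f \<circ> id" by simp
      ultimately show ?thesis by blast
    next
      assume "f \<in> Diff_sub k False False S S"
      then have "f \<circ> p \<in> Diff_sub k True True S S" using comp[OF _ p(1)] by fastforce
      moreover have "f = (f \<circ> p) \<circ> p" using p(2) by (simp add: comp_assoc)
      ultimately show ?thesis by blast
    qed
  next
    fix f assume "f \<in> {n \<circ> q | n q. n \<in> Diff_sub k True True S S \<and> q \<in> {id, p}}"
    then obtain n q where n: "f = n \<circ> q" "n \<in> Diff_sub k True True S S" "q = id \<or> q = p"
      by blast
    then have "f \<in> Diff_sub k True True S S \<union> Diff_sub k False False S S"
      using comp[OF n(2) p(1)] by auto
    then show "f \<in> Diff k S S" using split by blast
  qed
qed

lemma Diff_sub_True_True_normal: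
  assumes S: "is_Ck_structure k S" and f: "f \<in> Diff k S S" and n: "n \<in> Diff_sub k True True S S"
  shows "f \<circ> n \<circ> inv f \<in> Diff_sub k True True S S"
proof -
  note comp = Diff_sub_comp[OF S S S]
  obtain p s where f: "f \<in> Diff_sub k p s S S"
    using f unfolding Diff_eq_Union_Diff_sub[of k S S] by blast
  show ?thesis using comp[OF comp[OF f n] Diff_sub_inv[OF f]] by simp
qed

lemma transported_conjugation_by_involution:
  fixes N :: "('a \<Rightarrow> 'a) set" and E :: "('b \<Rightarrow> 'b) set"
  assumes bij: "bij_betw \<psi> N E" and hom: "\<And>m n. m \<in> N \<Longrightarrow> n \<in> N \<Longrightarrow> \<psi> (m \<circ> n) = \<psi> m \<circ> \<psi> n"
    and closed: "\<And>m n. m \<in> N \<Longrightarrow> n \<in> N \<Longrightarrow> m \<circ> n \<in> N" and conj: "\<And>n. n \<in> N \<Longrightarrow> p \<circ> n \<circ> p \<in> N"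
    and invol: "p \<circ> p = id"
  obtains \<sigma> where "bij_betw \<sigma> E E" "\<And>u v. u \<in> E \<Longrightarrow> v \<in> E \<Longrightarrow> \<sigma> (u \<circ> v) = \<sigma> u \<circ> \<sigma> v"
    "\<And>u. u \<in> E \<Longrightarrow> \<sigma> (\<sigma> u) = u" "\<And>n. n \<in> N \<Longrightarrow> \<sigma> (\<psi> n) = \<psi> (p \<circ> n \<circ> p)"
proof
  define \<sigma> where "\<sigma> u = \<psi> (p \<circ> inv_into N \<psi> u \<circ> p)" for u
  have E: "E = \<psi> ` N" and inj: "inj_on \<psi> N" using bij by (auto simp: bij_betw_def)
  have pp: "p (p x) = x" for x using fun_cong[OF invol, of x] by simp
  show \<sigma>: "\<sigma> (\<psi> n) = \<psi> (p \<circ> n \<circ> p)" if "n \<in> N" for n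
    using that inj by (simp add: \<sigma>_def inv_into_f_f)
  show \<sigma>\<sigma>: "\<sigma> (\<sigma> u) = u" if u: "u \<in> E" for u
  proof -
    obtain n where n: "n \<in> N" "u = \<psi> n" using u E by blast
    have "p \<circ> (p \<circ> n \<circ> p) \<circ> p = n" by (simp add: fun_eq_iff pp)
    then show ?thesis using n conj by (simp add: \<sigma>)
  qed
  show "\<sigma> (u \<circ> v) = \<sigma> u \<circ> \<sigma> v" if u: "u \<in> E" and v: "v \<in> E" for u v
  proof -
    obtain m n where m: "m \<in> N" "u = \<psi> m" and n: "n \<in> N" "v = \<psi> n" using u v E by blast
    have "\<sigma> (u \<circ> v) = \<psi> (p \<circ> (m \<circ> n) \<circ> p)" using m n \<sigma>[OF closed] by (simp add: hom)
    also have "p \<circ> (m \<circ> n) \<circ> p = (p \<circ> m \<circ> p) \<circ> (p \<circ> n \<circ> p)" by (simp add: fun_eq_iff pp)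
    also have "\<psi> \<dots> = \<sigma> u \<circ> \<sigma> v" using m n hom[OF conj conj] by (simp add: \<sigma>)
    finally show ?thesis .
  qed
  show "bij_betw \<sigma> E E"
    by (rule bij_betw_byWitness[where f' = \<sigma>]) (use \<sigma>\<sigma> \<sigma> conj E in auto)
qed

lemma semidirect_iso_of_involution:
  fixes N :: "('a \<Rightarrow> 'a) set" and E :: "('b \<Rightarrow> 'b) set"
  assumes bij: "bij_betw \<psi> N E" and hom: "\<And>m n. m \<in> N \<Longrightarrow> n \<in> N \<Longrightarrow> \<psi> (m \<circ> n) = \<psi> m \<circ> \<psi> n"
    and closed: "\<And>m n. m \<in> N \<Longrightarrow> n \<in> N \<Longrightarrow> m \<circ> n \<in> N" and conj: "\<And>n. n \<in> N \<Longrightarrow> p \<circ> n \<circ> p \<in> N"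
    and invol: "p \<circ> p = id" and coset: "\<And>n. n \<in> N \<Longrightarrow> n \<circ> p \<notin> N"
    and G: "G = {n \<circ> q | n q. n \<in> N \<and> q \<in> {id, p}}"
  shows "\<exists>(\<sigma> :: ('b \<Rightarrow> 'b) \<Rightarrow> ('b \<Rightarrow> 'b)) (\<Phi> :: ('a \<Rightarrow> 'a) \<Rightarrow> ('b \<Rightarrow> 'b) \<times> int).
    bij_betw \<sigma> E E \<and> (\<forall>u\<in>E. \<forall>v\<in>E. \<sigma> (u \<circ> v) = \<sigma> u \<circ> \<sigma> v) \<and> (\<forall>u\<in>E. \<sigma> (\<sigma> u) = u) \<and>
    bij_betw \<Phi> G (E \<times> Z2) \<and>
    (\<forall>f\<in>G. \<forall>g\<in>G.
      \<Phi> (f \<circ> g) = (fst (\<Phi> f) \<circ> (if snd (\<Phi> f) = 1 then fst (\<Phi> g) else \<sigma> (fst (\<Phi> g))),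
                     snd (\<Phi> f) * snd (\<Phi> g)))"
proof -
  obtain \<sigma> where \<sigma>: "bij_betw \<sigma> E E" "\<And>u v. u \<in> E \<Longrightarrow> v \<in> E \<Longrightarrow> \<sigma> (u \<circ> v) = \<sigma> u \<circ> \<sigma> v"
    "\<And>u. u \<in> E \<Longrightarrow> \<sigma> (\<sigma> u) = u" and \<sigma>\<psi>: "\<And>n. n \<in> N \<Longrightarrow> \<sigma> (\<psi> n) = \<psi> (p \<circ> n \<circ> p)"
    using transported_conjugation_by_involution[OF bij hom closed conj invol] by metis
  define \<Phi> :: "('a \<Rightarrow> 'a) \<Rightarrow> ('b \<Rightarrow> 'b) \<times> int"
    where "\<Phi> f = (if f \<in> N then (\<psi> f, 1) else (\<psi> (f \<circ> p), -1))" for f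
  have pp: "p (p x) = x" for x using fun_cong[OF invol, of x] by simp
  have \<Phi>: "\<Phi> n = (\<psi> n, 1)" "\<Phi> (n \<circ> p) = (\<psi> n, -1)" if "n \<in> N" for n
    using that coset invol by (simp_all add: \<Phi>_def comp_assoc)
  have G': "G = N \<union> (\<lambda>n. n \<circ> p) ` N" unfolding G by force
  have "bij_betw \<Phi> G (E \<times> Z2)"
    unfolding G'
    by (rule bij_betw_byWitness[where f' = "\<lambda>(u, e). inv_into N \<psi> u \<circ> (if e = 1 then id else p)"])
      (use bij in \<open>auto simp: bij_betw_def \<Phi> Z2_def inv_into_f_f\<close>)
  moreover have "\<Phi> (f \<circ> g) = (fst (\<Phi> f) \<circ> (if snd (\<Phi> f) = 1 then fst (\<Phi> g) else \<sigma> (fst (\<Phi> g))),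
      snd (\<Phi> f) * snd (\<Phi> g))" if f: "f \<in> G" and g: "g \<in> G" for f g
  proof -
    obtain m n where m: "m \<in> N" "f = m \<or> f = m \<circ> p" and n: "n \<in> N" "g = n \<or> g = n \<circ> p"
      using f g unfolding G' by blast
    note closed_mn = closed[OF m(1) n(1)] closed[OF m(1) conj[OF n(1)]]
    have "m \<circ> (n \<circ> p) = (m \<circ> n) \<circ> p" "(m \<circ> p) \<circ> n = (m \<circ> (p \<circ> n \<circ> p)) \<circ> p"
      "(m \<circ> p) \<circ> (n \<circ> p) = m \<circ> (p \<circ> n \<circ> p)" by (simp_all add: fun_eq_iff pp)
    with m(2) n(2) show ?thesis
      by (elim disjE) (simp_all only: \<Phi> m(1) n(1) closed_mn \<sigma>\<psi> hom conj fst_conv snd_conv, simp_all)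
  qed
  ultimately show ?thesis
    using \<sigma> by (intro exI[of _ \<sigma>] exI[of _ \<Phi>]) simp
qed

lemma Diff_S_a_semidirect:
  assumes k: "k \<ge> 1" and a: "a > 0" "a \<noteq> 1"
  shows "\<exists>p\<in>Diff_sub k False False (S_a k a) (S_a k a).
        p \<circ> p = id \<and> p \<noteq> id \<and>
        (\<forall>f\<in>Diff k (S_a k a) (S_a k a). \<forall>n\<in>Diff_sub k True True (S_a k a) (S_a k a).
           f \<circ> n \<circ> inv f \<in> Diff_sub k True True (S_a k a) (S_a k a)) \<and>
        Diff k (S_a k a) (S_a k a) =
          {n \<circ> q | n q. n \<in> Diff_sub k True True (S_a k a) (S_a k a) \<and> q \<in> {id, p}} \<and>
        Diff_sub k True True (S_a k a) (S_a k a) \<inter> {id, p} = {id}"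
proof -
  let ?p = "lift False (flip a)"
  note p = lift_flip_in_Diff_sub[OF a(1), of k] lift_flip_involution[OF a(1)]
  note S = is_Ck_structure_S_a[OF a(1), of k]
  have "?p \<notin> Diff_sub k True True (S_a k a) (S_a k a)" using Diff_sub_disjoint(1)[OF p(1)] by blast
  then have "?p \<noteq> id" "Diff_sub k True True (S_a k a) (S_a k a) \<inter> {id, ?p} = {id}"
    using id_in_Diff_sub[OF S] by auto
  then show ?thesis
    using Diff_eq_cosets_of_involution[OF S Diff_S_a_decomposition(3)[OF k a] p]
      Diff_sub_True_True_normal[OF S]
    by (intro bexI[of _ ?p] conjI ballI p)
qed

lemma Diff_S_a_iso_semidirect:
  assumes k: "k \<ge> 1" and a: "a > 0" "a \<noteq> 1"
  shows "\<exists>(\<sigma> :: (real \<Rightarrow> real) \<Rightarrow> (real \<Rightarrow> real)) (\<Phi> :: (L \<Rightarrow> L) \<Rightarrow> (real \<Rightarrow> real) \<times> int).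
        bij_betw \<sigma> (Ek_plus k) (Ek_plus k) \<and>
        (\<forall>u\<in>Ek_plus k. \<forall>v\<in>Ek_plus k. \<sigma> (u \<circ> v) = \<sigma> u \<circ> \<sigma> v) \<and>
        (\<forall>u\<in>Ek_plus k. \<sigma> (\<sigma> u) = u) \<and>
        bij_betw \<Phi> (Diff k (S_a k a) (S_a k a)) (Ek_plus k \<times> Z2) \<and>
        (\<forall>f\<in>Diff k (S_a k a) (S_a k a). \<forall>g\<in>Diff k (S_a k a) (S_a k a).
           \<Phi> (f \<circ> g) = (fst (\<Phi> f) \<circ> (if snd (\<Phi> f) = 1 then fst (\<Phi> g) else \<sigma> (fst (\<Phi> g))),
                         snd (\<Phi> f) * snd (\<Phi> g)))"
proof -
  let ?N = "Diff_sub k True True (S_a k a) (S_a k a)"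
  obtain \<psi> where \<psi>: "bij_betw \<psi> ?N (Ek_plus k)" "\<forall>f\<in>?N. \<forall>g\<in>?N. \<psi> (f \<circ> g) = \<psi> f \<circ> \<psi> g"
    using Diff_sub_iso_Ek_plus[OF assms] by blast
  obtain p where p: "p \<in> Diff_sub k False False (S_a k a) (S_a k a)" "p \<circ> p = id"
    and G: "Diff k (S_a k a) (S_a k a) = {n \<circ> q | n q. n \<in> ?N \<and> q \<in> {id, p}}"
    using Diff_S_a_semidirect[OF assms] by blast
  note S = is_Ck_structure_S_a[OF a(1), of k]
  note comp = Diff_sub_comp[OF S S S]
  show ?thesis
  proof (rule semidirect_iso_of_involution[OF \<psi>(1) _ _ _ p(2) _ G])
    fix m n assume m: "m \<in> ?N" and n: "n \<in> ?N"
    show "\<psi> (m \<circ> n) = \<psi> m \<circ> \<psi> n" using \<psi>(2) m n by blast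
    show "m \<circ> n \<in> ?N" using comp[OF m n] by simp
  next
    fix n assume n: "n \<in> ?N"
    show "p \<circ> n \<circ> p \<in> ?N" using comp[OF comp[OF p(1) n] p(1)] by simp
    show "n \<circ> p \<notin> ?N" using comp[OF n p(1)] Diff_sub_disjoint(1) by fastforce
  qed
qed

lemma Diff_S_a_inverse_decomposition:
  assumes "k \<ge> 1" "a > 0" "a \<noteq> 1"
  shows "Diff k (S_a k a) (S_a k (1/a)) \<noteq> {}"
    "Diff_sub k True True (S_a k a) (S_a k (1/a)) = {}"
    "Diff_sub k False False (S_a k a) (S_a k (1/a)) = {}"
    "Diff k (S_a k a) (S_a k (1/a)) =
       Diff_sub k True False (S_a k a) (S_a k (1/a)) \<union> Diff_sub k False True (S_a k a) (S_a k (1/a))"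
    "Diff_sub k True False (S_a k a) (S_a k (1/a)) \<inter> Diff_sub k False True (S_a k a) (S_a k (1/a)) = {}"
proof -
  show "Diff k (S_a k a) (S_a k (1/a)) \<noteq> {}"
    using lift_w_in_Diff_sub[OF assms(2)] Diff_sub_subset_Diff by blast
  have empty: "Diff_sub k p s (S_a k a) (S_a k (1/a)) = {}" if "(p = s) \<noteq> False" for p s
    using Diff_sub_S_a_empty[OF assms(1,2), of "1 / a"] neq_inverse[OF assms(2,3)] assms(2) that
    by simp
  then show "Diff_sub k True True (S_a k a) (S_a k (1/a)) = {}"
    "Diff_sub k False False (S_a k a) (S_a k (1/a)) = {}" by blast+
  show "Diff k (S_a k a) (S_a k (1/a)) =
      Diff_sub k True False (S_a k a) (S_a k (1/a)) \<union> Diff_sub k False True (S_a k a) (S_a k (1/a))"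
    using Diff_eq_Un_if_Diff_sub_empty[of False, OF empty] by simp
qed (use Diff_sub_disjoint(1) in blast)

lemma bij_betw_comp_Diff_sub_S_a_inverse:
  assumes a: "a > 0"
  shows "\<forall>h\<in>Diff_sub k False True (S_a k a) (S_a k (1/a)). \<forall>g\<in>Diff_sub k True False (S_a k a) (S_a k (1/a)).
        bij_betw (\<lambda>\<kappa>. inv g \<circ> \<kappa>) (Diff_sub k True False (S_a k a) (S_a k (1/a)))
                                 (Diff_sub k True True (S_a k a) (S_a k a)) \<and>
        bij_betw (\<lambda>\<kappa>. h \<circ> \<kappa>) (Diff_sub k True True (S_a k a) (S_a k a))
                             (Diff_sub k False True (S_a k a) (S_a k (1/a)))"
proof (intro ballI conjI)
  fix h g assume h: "h \<in> Diff_sub k False True (S_a k a) (S_a k (1/a))"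
    and g: "g \<in> Diff_sub k True False (S_a k a) (S_a k (1/a))"
  have S: "is_Ck_structure k (S_a k a)" and T: "is_Ck_structure k (S_a k (1/a))"
    using a by (simp_all add: is_Ck_structure_S_a)
  show "bij_betw (\<lambda>\<kappa>. inv g \<circ> \<kappa>) (Diff_sub k True False (S_a k a) (S_a k (1/a)))
      (Diff_sub k True True (S_a k a) (S_a k a))"
    using bij_betw_comp_Diff_sub[OF S T S Diff_sub_inv[OF g], of True False] by simp
  show "bij_betw (\<lambda>\<kappa>. h \<circ> \<kappa>) (Diff_sub k True True (S_a k a) (S_a k a))
      (Diff_sub k False True (S_a k a) (S_a k (1/a)))"
    using bij_betw_comp_Diff_sub[OF S S T h, of True True] by simp
qed

lemma Diff_S_a_S_b_empty:
  assumes "k \<ge> 1" "a > 0" "b > 0" "a \<noteq> b" "a \<noteq> 1 / b"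
  shows "Diff k (S_a k a) (S_a k b) = {}"
  unfolding Diff_eq_Union_Diff_sub[of k "S_a k a"]
  using Diff_sub_S_a_empty[OF assms(1-3)] assms(4,5) by simp

lemma uncountable_Ck_structures:
  assumes k: "k \<ge> 1"
  shows "\<exists>\<A> :: chart set set set. uncountable \<A> \<and> (\<forall>S\<in>\<A>. is_Ck_structure k S) \<and>
     (\<forall>S\<in>\<A>. \<forall>T\<in>\<A>. S \<noteq> T \<longrightarrow> Diff k S T = {})"
proof (intro exI[of _ "S_a k ` {0<..<1}"] conjI ballI impI)
  have empty: "Diff k (S_a k a) (S_a k b) = {}" if "a \<in> {0<..<1}" "b \<in> {0<..<1}" "a \<noteq> b" for a b
  proof -
    have "1 / b > 1" using that by simp
    then show ?thesis using that by (intro Diff_S_a_S_b_empty[OF k]) auto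
  qed
  have "inj_on (S_a k) {0<..<1}"
  proof (rule inj_onI, rule ccontr)
    fix a b :: real assume ab: "a \<in> {0<..<1}" "b \<in> {0<..<1}" "S_a k a = S_a k b" "a \<noteq> b"
    then have "id \<in> Diff k (S_a k a) (S_a k b)"
      using id_in_Diff[OF is_Ck_structure_S_a[of a k]] by simp
    then show False using empty[OF ab(1,2,4)] by simp
  qed
  then show "uncountable (S_a k ` {0<..<1})"
    using countable_image_inj_on uncountable_open_interval[of 0 "1::real"] by auto
  show "is_Ck_structure k S" if "S \<in> S_a k ` {0<..<1}" for S
    using that is_Ck_structure_S_a by auto
  show "Diff k S T = {}" if "S \<in> S_a k ` {0<..<1}" "T \<in> S_a k ` {0<..<1}" "S \<noteq> T" for S T
    using that empty by (elim imageE) metis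
qed

theorem theorem1p7:
  fixes k :: enat
  assumes k: "k \<ge> 1"
  shows
  \<comment> \<open>(1)\<close>
  "(\<exists>\<eta> :: (L \<Rightarrow> L) \<Rightarrow> (real \<Rightarrow> real) \<times> int.
      bij_betw \<eta> (Diff k (S_a k 1) (S_a k 1)) (Dk k \<times> Z2) \<and>
      (\<forall>f\<in>Diff k (S_a k 1) (S_a k 1). \<forall>g\<in>Diff k (S_a k 1) (S_a k 1).
         \<eta> (f \<circ> g) = (fst (\<eta> f) \<circ> fst (\<eta> g), snd (\<eta> f) * snd (\<eta> g))) \<and>
      \<eta> ` Diff_sub k True True (S_a k 1) (S_a k 1) = Dk_plus k \<times> {1} \<and>
      \<eta> ` Diff_sub k False True (S_a k 1) (S_a k 1) = Dk_minus k \<times> {1} \<and>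
      \<eta> ` Diff_sub k True False (S_a k 1) (S_a k 1) = Dk_plus k \<times> {-1} \<and>
      \<eta> ` Diff_sub k False False (S_a k 1) (S_a k 1) = Dk_minus k \<times> {-1})
   \<and>
  \<comment> \<open>(2)\<close>
  (\<forall>a::real. a > 0 \<and> a \<noteq> 1 \<longrightarrow>
     Diff_sub k True False (S_a k a) (S_a k a) = {} \<and>
     Diff_sub k False True (S_a k a) (S_a k a) = {} \<and>
     Diff k (S_a k a) (S_a k a) =
       Diff_sub k True True (S_a k a) (S_a k a) \<union> Diff_sub k False False (S_a k a) (S_a k a) \<and>
     Diff_sub k True True (S_a k a) (S_a k a) \<inter> Diff_sub k False False (S_a k a) (S_a k a) = {} \<and>
     (\<exists>\<psi> :: (L \<Rightarrow> L) \<Rightarrow> (real \<Rightarrow> real).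
        bij_betw \<psi> (Diff_sub k True True (S_a k a) (S_a k a)) (Ek_plus k) \<and>
        (\<forall>f\<in>Diff_sub k True True (S_a k a) (S_a k a). \<forall>g\<in>Diff_sub k True True (S_a k a) (S_a k a).
           \<psi> (f \<circ> g) = \<psi> f \<circ> \<psi> g)) \<and>
     (\<exists>p\<in>Diff_sub k False False (S_a k a) (S_a k a).
        p \<circ> p = id \<and> p \<noteq> id \<and>
        (\<forall>f\<in>Diff k (S_a k a) (S_a k a). \<forall>n\<in>Diff_sub k True True (S_a k a) (S_a k a).
           f \<circ> n \<circ> inv f \<in> Diff_sub k True True (S_a k a) (S_a k a)) \<and>
        Diff k (S_a k a) (S_a k a) =
          {n \<circ> q | n q. n \<in> Diff_sub k True True (S_a k a) (S_a k a) \<and> q \<in> {id, p}} \<and>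
        Diff_sub k True True (S_a k a) (S_a k a) \<inter> {id, p} = {id}) \<and>
     (\<exists>(\<sigma> :: (real \<Rightarrow> real) \<Rightarrow> (real \<Rightarrow> real)) (\<Phi> :: (L \<Rightarrow> L) \<Rightarrow> (real \<Rightarrow> real) \<times> int).
        bij_betw \<sigma> (Ek_plus k) (Ek_plus k) \<and>
        (\<forall>u\<in>Ek_plus k. \<forall>v\<in>Ek_plus k. \<sigma> (u \<circ> v) = \<sigma> u \<circ> \<sigma> v) \<and>
        (\<forall>u\<in>Ek_plus k. \<sigma> (\<sigma> u) = u) \<and>
        bij_betw \<Phi> (Diff k (S_a k a) (S_a k a)) (Ek_plus k \<times> Z2) \<and>
        (\<forall>f\<in>Diff k (S_a k a) (S_a k a). \<forall>g\<in>Diff k (S_a k a) (S_a k a).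
           \<Phi> (f \<circ> g) = (fst (\<Phi> f) \<circ> (if snd (\<Phi> f) = 1 then fst (\<Phi> g) else \<sigma> (fst (\<Phi> g))),
                         snd (\<Phi> f) * snd (\<Phi> g)))))
   \<and>
  \<comment> \<open>(3)\<close>
  (\<forall>a::real. a > 0 \<and> a \<noteq> 1 \<longrightarrow>
     Diff k (S_a k a) (S_a k (1/a)) \<noteq> {} \<and>
     Diff_sub k True True (S_a k a) (S_a k (1/a)) = {} \<and>
     Diff_sub k False False (S_a k a) (S_a k (1/a)) = {} \<and>
     Diff k (S_a k a) (S_a k (1/a)) =
       Diff_sub k True False (S_a k a) (S_a k (1/a)) \<union> Diff_sub k False True (S_a k a) (S_a k (1/a)) \<and>
     Diff_sub k True False (S_a k a) (S_a k (1/a)) \<inter> Diff_sub k False True (S_a k a) (S_a k (1/a)) = {} \<and>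
     (\<forall>h\<in>Diff_sub k False True (S_a k a) (S_a k (1/a)). \<forall>g\<in>Diff_sub k True False (S_a k a) (S_a k (1/a)).
        bij_betw (\<lambda>\<kappa>. inv g \<circ> \<kappa>) (Diff_sub k True False (S_a k a) (S_a k (1/a)))
                                 (Diff_sub k True True (S_a k a) (S_a k a)) \<and>
        bij_betw (\<lambda>\<kappa>. h \<circ> \<kappa>) (Diff_sub k True True (S_a k a) (S_a k a))
                             (Diff_sub k False True (S_a k a) (S_a k (1/a)))))
   \<and>
  \<comment> \<open>(4)\<close>
  (\<forall>a b::real. a > 0 \<and> b > 0 \<and> a \<noteq> b \<and> a \<noteq> 1/b \<longrightarrow> Diff k (S_a k a) (S_a k b) = {}) \<and>
  (\<exists>\<A> :: chart set set set. uncountable \<A> \<and> (\<forall>S\<in>\<A>. is_Ck_structure k S) \<and>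
     (\<forall>S\<in>\<A>. \<forall>T\<in>\<A>. S \<noteq> T \<longrightarrow> Diff k S T = {}))"
proof -
  note trivial_twist = Diff_S_1_iso[of k]
  note nontrivial_twist = Diff_S_a_decomposition[OF k] Diff_sub_iso_Ek_plus[OF k]
    Diff_S_a_semidirect[OF k] Diff_S_a_iso_semidirect[OF k]
  note inverse_twist = Diff_S_a_inverse_decomposition[OF k] bij_betw_comp_Diff_sub_S_a_inverse
  note distinct_twists = Diff_S_a_S_b_empty[OF k] uncountable_Ck_structures[OF k]
  show ?thesis
    by (intro conjI allI impI; (elim conjE)?)
      (rule trivial_twist nontrivial_twist inverse_twist distinct_twists; assumption)+
qed

end
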